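(* Let $X$ be a complex Banach space, $A\in B(X)$, and let $\Lambda$ be a spectral set for $A$. If $0\notin\Lambda$, then $A$ is Mary invertible along the spectral projection $P_\Lambda(A)$.
   Context: $\sigma(A)$ is the spectrum of $A$ and $R_\lambda(A)=(A-\lambda I)^{-1}$ for $\lambda\notin\sigma(A)$. A subset $\Lambda\subset\sigma(A)$ is a spectral set if both $\Lambda$ and $\sigma(A)\setminus\Lambda$ are closed. The spectral projection is $P_\Lambda(A)=-\frac{1}{2\pi i}\int_C R_\lambda(A)\,d\lambda$, where $C$ is a Cauchy contour separating $\Lambda$ from $\sigma(A)\setminus\Lambda$. $A$ is Mary invertible along $T\in B(X)$ if there exists $B\in B(X)$ with $BAB=B$ and $L,U,V,W\in B(X)$ such that $B=TU$, $T=BW$, $B=LT$, $T=VB$. *)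

theory Defs
  imports "HOL-Complex_Analysis.Complex_Analysis"
begin

text \<open>A complex Banach space X is modelled as a real Banach space 'x together with a
  complex structure J (multiplication by i): a bounded real-linear map with J (J x) = -x
  such that the induced complex scalar multiplication is absolutely homogeneous.\<close>

definition cscale :: "('x::banach \<Rightarrow>\<^sub>L 'x) \<Rightarrow> complex \<Rightarrow> 'x \<Rightarrow> 'x" where
  "cscale J c x = Re c *\<^sub>R x + Im c *\<^sub>R blinfun_apply J x"

definition complex_structure :: "('x::banach \<Rightarrow>\<^sub>L 'x) \<Rightarrow> bool" where
  "complex_structure J \<longleftrightarrow>
     (\<forall>x. blinfun_apply J (blinfun_apply J x) = - x) \<and>
     (\<forall>c x. norm (cscale J c x) = cmod c * norm x)"

text \<open>B(X): the bounded complex-linear operators, i.e. bounded real-linear operators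
  commuting with J.\<close>
definition BX :: "('x::banach \<Rightarrow>\<^sub>L 'x) \<Rightarrow> ('x \<Rightarrow>\<^sub>L 'x) set" where
  "BX J = {T. T o\<^sub>L J = J o\<^sub>L T}"

definition cI :: "('x::banach \<Rightarrow>\<^sub>L 'x) \<Rightarrow> complex \<Rightarrow> ('x \<Rightarrow>\<^sub>L 'x)" where
  "cI J c = Re c *\<^sub>R id_blinfun + Im c *\<^sub>R J"

definition invertible_op :: "('x::banach \<Rightarrow>\<^sub>L 'x) \<Rightarrow> ('x \<Rightarrow>\<^sub>L 'x) \<Rightarrow> bool" where
  "invertible_op J T \<longleftrightarrow>
     (\<exists>S\<in>BX J. S o\<^sub>L T = id_blinfun \<and> T o\<^sub>L S = id_blinfun)"

definition op_spectrum :: "('x::banach \<Rightarrow>\<^sub>L 'x) \<Rightarrow> ('x \<Rightarrow>\<^sub>L 'x) \<Rightarrow> complex set" where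
  "op_spectrum J A = {l. \<not> invertible_op J (A - cI J l)}"

definition resolvent :: "('x::banach \<Rightarrow>\<^sub>L 'x) \<Rightarrow> ('x \<Rightarrow>\<^sub>L 'x) \<Rightarrow> complex \<Rightarrow> ('x \<Rightarrow>\<^sub>L 'x)" where
  "resolvent J A l = (THE S. S \<in> BX J \<and> S o\<^sub>L (A - cI J l) = id_blinfun
                              \<and> (A - cI J l) o\<^sub>L S = id_blinfun)"

definition spectral_set :: "('x::banach \<Rightarrow>\<^sub>L 'x) \<Rightarrow> ('x \<Rightarrow>\<^sub>L 'x) \<Rightarrow> complex set \<Rightarrow> bool" where
  "spectral_set J A \<Lambda> \<longleftrightarrow>
     \<Lambda> \<subseteq> op_spectrum J A \<and> closed \<Lambda> \<and> closed (op_spectrum J A - \<Lambda>)"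

text \<open>Contour integral of an operator-valued function along a path g : [0,1] -> C,
  defined exactly as the library's contour integral with complex scalar multiplication
  by the derivative replaced by composition with (g' t) I.\<close>
definition op_contour_integral ::
  "('x::banach \<Rightarrow>\<^sub>L 'x) \<Rightarrow> (real \<Rightarrow> complex) \<Rightarrow> (complex \<Rightarrow> ('x \<Rightarrow>\<^sub>L 'x)) \<Rightarrow> ('x \<Rightarrow>\<^sub>L 'x)" where
  "op_contour_integral J g f =
     integral {0..1} (\<lambda>t. f (g t) o\<^sub>L cI J (vector_derivative g (at t within {0..1})))"

definition cauchy_contour ::
  "('x::banach \<Rightarrow>\<^sub>L 'x) \<Rightarrow> ('x \<Rightarrow>\<^sub>L 'x) \<Rightarrow> complex set \<Rightarrow> (real \<Rightarrow> complex) list \<Rightarrow> bool" where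
  "cauchy_contour J A \<Lambda> C \<longleftrightarrow>
     (\<forall>g\<in>set C. valid_path g \<and> pathfinish g = pathstart g \<and>
                path_image g \<inter> op_spectrum J A = {}) \<and>
     (\<forall>z\<in>\<Lambda>. (\<Sum>g\<leftarrow>C. winding_number g z) = 1) \<and>
     (\<forall>z\<in>op_spectrum J A - \<Lambda>. (\<Sum>g\<leftarrow>C. winding_number g z) = 0)"

definition spectral_projection ::
  "('x::banach \<Rightarrow>\<^sub>L 'x) \<Rightarrow> ('x \<Rightarrow>\<^sub>L 'x) \<Rightarrow> (real \<Rightarrow> complex) list \<Rightarrow> ('x \<Rightarrow>\<^sub>L 'x)" where
  "spectral_projection J A C =
     cI J (- 1 / (2 * of_real pi * \<i>)) o\<^sub>L (\<Sum>g\<leftarrow>C. op_contour_integral J g (resolvent J A))"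

definition mary_invertible_along ::
  "('x::banach \<Rightarrow>\<^sub>L 'x) \<Rightarrow> ('x \<Rightarrow>\<^sub>L 'x) \<Rightarrow> ('x \<Rightarrow>\<^sub>L 'x) \<Rightarrow> bool" where
  "mary_invertible_along J A T \<longleftrightarrow>
     (\<exists>B\<in>BX J. B o\<^sub>L A o\<^sub>L B = B \<and>
        (\<exists>L\<in>BX J. \<exists>U\<in>BX J. \<exists>V\<in>BX J. \<exists>W\<in>BX J.
           B = T o\<^sub>L U \<and> T = B o\<^sub>L W \<and> B = L o\<^sub>L T \<and> T = V o\<^sub>L B))"

end

theory Submission
  imports Defs
begin

text \<open>Write \<open>R\<^sub>\<mu>\<close> for the resolvent, \<open>P\<close> for the spectral projection and \<open>F(\<mu>)\<close> for
  the Cauchy transform \<open>1/(2\<pi>i) \<integral> R\<^sub>\<lambda> / (\<lambda> - \<mu>) d\<lambda>\<close>. Off the contour,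
  \<open>F(\<mu>) (A - \<mu>) = (A - \<mu>) F(\<mu>) = n(\<mu>) - P\<close> with \<open>n\<close> the winding number. Hence the function
  \<open>P (1 - P) R\<^sub>\<mu>\<close> continues analytically across the whole spectrum, by \<open>P F(\<mu>)\<close> near \<open>\<Lambda>\<close> and by
  \<open>- (1 - P) F(\<mu>)\<close> near the rest; it vanishes at infinity, so it is zero by Liouville's theorem and
  \<open>P\<close> is idempotent. If \<open>0\<close> lies in the spectrum then \<open>n(0) = 0\<close> and \<open>S = - F(0)\<close> satisfies
  \<open>S A = A S = P\<close>; otherwise \<open>S = A\<^sup>-\<^sup>1 P\<close> does. In both cases \<open>S P\<close> is the inverse along \<open>P\<close>.\<close>

section \<open>Differentiation and integration with values in a complex Banach space\<close>

text \<open>The complex structure on operators depends on the term \<open>J\<close>, so complex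
  scalar multiplication is a parameter here; it is instantiated later by composition with
  \<open>cI J c\<close>.\<close>

locale complex_banach = bounded_bilinear sc
  for sc :: "complex \<Rightarrow> 'e::banach \<Rightarrow> 'e" (infixr "\<odot>" 75) +
  assumes one_sc [simp]: "1 \<odot> x = x"
    and mult_sc: "(a * b) \<odot> x = a \<odot> b \<odot> x"
begin

lemma sc_left_commute: "a \<odot> b \<odot> x = b \<odot> a \<odot> x"
  by (metis mult.commute mult_sc)

definition has_cderiv :: "(complex \<Rightarrow> 'e) \<Rightarrow> 'e \<Rightarrow> complex \<Rightarrow> bool" where
  "has_cderiv f D z \<longleftrightarrow> (f has_derivative (\<lambda>h. h \<odot> D)) (at z)"

text \<open>The map taking \<open>h\<close> to \<open>h \<odot> D\<close> has the value
  \<open>D\<close> at 1, which recovers the derivative vector from the Frechet derivative.\<close>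

definition cderiv :: "(complex \<Rightarrow> 'e) \<Rightarrow> complex \<Rightarrow> 'e" where
  "cderiv f z = frechet_derivative f (at z) 1"

text \<open>Continuity of the derivative is built in, which spares Goursat's argument: primitives
  and Liouville's theorem then come from differentiation under the integral sign.\<close>

definition C1_holo :: "(complex \<Rightarrow> 'e) \<Rightarrow> complex set \<Rightarrow> bool" where
  "C1_holo f U \<longleftrightarrow> (\<forall>z\<in>U. has_cderiv f (cderiv f z) z) \<and> continuous_on U (cderiv f)"

lemma has_cderiv_imp_cderiv: "has_cderiv f D z \<Longrightarrow> cderiv f z = D"
  unfolding has_cderiv_def cderiv_def by (metis frechet_derivative_at one_sc)

lemma C1_holoI:
  assumes "\<And>z. z \<in> U \<Longrightarrow> has_cderiv f (f' z) z" "continuous_on U f'"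
  shows "C1_holo f U"
  using assms has_cderiv_imp_cderiv unfolding C1_holo_def
  by (metis (no_types, lifting) continuous_on_cong)

lemma C1_holo_imp_continuous_on: "C1_holo f U \<Longrightarrow> continuous_on U f"
  unfolding C1_holo_def has_cderiv_def
  by (meson continuous_at_imp_continuous_on has_derivative_continuous)

lemma C1_holo_subset: "C1_holo f U \<Longrightarrow> V \<subseteq> U \<Longrightarrow> C1_holo f V"
  unfolding C1_holo_def by (blast intro: continuous_on_subset)

lemma has_cderiv_transform_open:
  assumes "has_cderiv f D z" "open V" "z \<in> V" "\<And>w. w \<in> V \<Longrightarrow> f w = g w"
  shows "has_cderiv g D z"
  using assms unfolding has_cderiv_def
  by (metis has_derivative_transform_within_open)

lemma C1_holo_transform_open:
  assumes "C1_holo f V" "open V" "\<And>w. w \<in> V \<Longrightarrow> f w = g w"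
  shows "C1_holo g V"
  by (rule C1_holoI[where f' = "cderiv f"])
    (use assms in \<open>auto simp: C1_holo_def intro: has_cderiv_transform_open\<close>)

lemma C1_holo_locally:
  assumes "\<And>z. z \<in> U \<Longrightarrow> \<exists>V. open V \<and> z \<in> V \<and> C1_holo f V"
  shows "C1_holo f U"
proof -
  have "isCont (cderiv f) z \<and> has_cderiv f (cderiv f z) z" if "z \<in> U" for z
    using assms[OF that] unfolding C1_holo_def
    by (metis continuous_on_eq_continuous_at)
  then show ?thesis
    unfolding C1_holo_def by (blast intro: continuous_at_imp_continuous_on)
qed

lemma has_cderiv_bounded_linear:
  assumes "has_cderiv f D z" "bounded_linear T" "\<And>c x. T (c \<odot> x) = c \<odot> T x"
  shows "has_cderiv (\<lambda>w. T (f w)) (T D) z"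
  using bounded_linear.has_derivative[OF assms(2) assms(1)[unfolded has_cderiv_def]]
  unfolding has_cderiv_def assms(3) .

lemma C1_holo_bounded_linear:
  assumes "C1_holo f U" "bounded_linear T" "\<And>c x. T (c \<odot> x) = c \<odot> T x"
  shows "C1_holo (\<lambda>w. T (f w)) U"
  by (rule C1_holoI[where f' = "\<lambda>z. T (cderiv f z)"])
    (use assms in \<open>auto simp: C1_holo_def
      intro: has_cderiv_bounded_linear bounded_linear.continuous_on\<close>)

lemma has_cderiv_compose:
  assumes "has_cderiv f D (\<gamma> t)" "(\<gamma> has_vector_derivative \<gamma>') (at t within S)"
  shows "((\<lambda>t. f (\<gamma> t)) has_vector_derivative \<gamma>' \<odot> D) (at t within S)"
  using has_derivative_compose[OF assms(2)[unfolded has_vector_derivative_def]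
      assms(1)[unfolded has_cderiv_def]]
  by (simp add: has_vector_derivative_def scaleR_left)

text \<open>Caratheodory's form of differentiability: the remainder is
  \<open>(w - z) \<odot> (q w - q z)\<close>, of lower order than \<open>w - z\<close> by continuity
  of \<open>q\<close>. Cauchy transforms and resolvents have such a \<open>q\<close> in closed
  form.\<close>

lemma has_cderiv_factorization:
  assumes V: "open V" "z \<in> V" and q: "\<And>w. w \<in> V \<Longrightarrow> f w - f z = (w - z) \<odot> q w"
    and cont: "continuous_on V q"
  shows "has_cderiv f (q z) z"
proof -
  obtain K where K: "K \<ge> 0" "\<And>a x. norm (a \<odot> x) \<le> norm a * norm x * K"
    using nonneg_bounded by blast
  have "(q \<longlongrightarrow> q z) (at z)"
    using cont V by (metis continuous_on_eq_continuous_at isCont_def)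
  then have lim: "((\<lambda>w. norm (q w - q z) * K) \<longlongrightarrow> 0) (at z)"
    by (auto intro!: tendsto_mult_left_zero tendsto_norm_zero LIM_zero)
  have "\<forall>\<^sub>F w in at z. norm ((f w - f z - (w - z) \<odot> q z) /\<^sub>R norm (w - z)) \<le> norm (q w - q z) * K"
  proof (rule eventually_mono[OF eventually_at_in_open[OF V]])
    fix w assume w: "w \<in> V - {z}"
    have "f w - f z - (w - z) \<odot> q z = (w - z) \<odot> (q w - q z)"
      using q w by (simp add: diff_right)
    then have "norm (f w - f z - (w - z) \<odot> q z) \<le> norm (w - z) * (norm (q w - q z) * K)"
      using K(2)[of "w - z" "q w - q z"] by (simp add: mult.assoc)
    then show "norm ((f w - f z - (w - z) \<odot> q z) /\<^sub>R norm (w - z)) \<le> norm (q w - q z) * K"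
      using w by (simp add: divide_simps mult.commute)
  qed
  then have "((\<lambda>w. (f w - f z - (w - z) \<odot> q z) /\<^sub>R norm (w - z)) \<longlongrightarrow> 0) (at z)"
    using lim by (rule Lim_null_comparison)
  then show ?thesis
    unfolding has_cderiv_def has_derivative_at_within
    by (simp add: bounded_linear_left)
qed

text \<open>The Leibniz rule for parameter integrals takes derivatives as bounded operators; this is
  the derivative operator attached to the vector \<open>x\<close>.\<close>

definition sc_blinfun :: "'e \<Rightarrow> complex \<Rightarrow>\<^sub>L 'e" where
  "sc_blinfun x = Blinfun (\<lambda>h. h \<odot> x)"

lemma sc_blinfun_apply [simp]: "blinfun_apply (sc_blinfun x) h = h \<odot> x"
  unfolding sc_blinfun_def by (simp add: bounded_linear_Blinfun_apply bounded_linear_left)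

lemma bounded_linear_sc_blinfun: "bounded_linear sc_blinfun"
proof -
  obtain K where K: "K \<ge> 0" "\<And>a x. norm (a \<odot> x) \<le> norm a * norm x * K"
    using nonneg_bounded by blast
  show ?thesis
  proof (rule bounded_linear_intro)
    show "norm (sc_blinfun x) \<le> norm x * K" for x
      using K by (intro norm_blinfun_bound) (auto simp: ac_simps)
  qed (auto intro!: blinfun_eqI simp: blinfun.bilinear_simps add_right scaleR_right)
qed

text \<open>The primitive integrates \<open>f\<close> along the segment from a base point
  \<open>z0\<close>. Differentiation under the integral produces an exact derivative in the segment
  parameter, whose integral is \<open>f z\<close>.\<close>

lemma C1_holo_primitive:
  assumes f: "C1_holo f U" and U: "open U" "convex U"
  obtains \<Phi> where "\<And>z. z \<in> U \<Longrightarrow> has_cderiv \<Phi> (f z) z"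
proof (cases "U = {}")
  case False
  then obtain z0 where z0: "z0 \<in> U" by blast
  define w where "w z s = z0 + s *\<^sub>R (z - z0)" for z and s :: real
  have wU: "w z s \<in> U" if "z \<in> U" "s \<in> cbox 0 1" for z s
  proof -
    have "w z s = (1 - s) *\<^sub>R z0 + s *\<^sub>R z"
      by (simp add: w_def algebra_simps)
    then show ?thesis
      using U(2) z0 that by (auto simp: convex_alt)
  qed
  have contw: "continuous_on X (\<lambda>p. w (fst p) (snd p))" for X
    unfolding w_def by (intro continuous_intros)
  have contf: "continuous_on (U \<times> cbox 0 1) (\<lambda>p. f (w (fst p) (snd p)))"
    by (rule continuous_on_compose2[OF C1_holo_imp_continuous_on[OF f] contw])
      (auto intro!: wU)
  have contf': "continuous_on (U \<times> cbox 0 1) (\<lambda>p. cderiv f (w (fst p) (snd p)))"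
    by (rule continuous_on_compose2[OF _ contw]) (use f in \<open>auto simp: C1_holo_def intro!: wU\<close>)
  \<comment> \<open>This is both the derivative of \<open>s *\<^sub>R f (w z s)\<close> in
    \<open>s\<close> and the derivative vector in \<open>z\<close> of the integrand of
    \<open>\<Phi>\<close> below; the first reading evaluates its integral.\<close>
  define k where "k z s = f (w z s) + s *\<^sub>R ((z - z0) \<odot> cderiv f (w z s))" for z s
  have contk: "continuous_on (U \<times> cbox 0 1) (\<lambda>p. k (fst p) (snd p))"
    unfolding k_def by (intro continuous_intros continuous_on contf contf')
  define \<Phi> where "\<Phi> z = integral (cbox 0 1) (\<lambda>s. (z - z0) \<odot> f (w z s))" for z
  have k_int: "((\<lambda>s. k z s) has_integral f z) (cbox 0 1)" if z: "z \<in> U" for z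
  proof -
    have "((\<lambda>s. s *\<^sub>R f (w z s)) has_vector_derivative k z s) (at s within {0..1})"
      if "s \<in> {0..1}" for s
    proof -
      have w': "(w z has_vector_derivative (z - z0)) (at s within {0..1})"
        unfolding w_def by (auto intro!: derivative_eq_intros)
      have "((\<lambda>s. f (w z s)) has_vector_derivative (z - z0) \<odot> cderiv f (w z s)) (at s within {0..1})"
        by (rule has_cderiv_compose[OF _ w']) (use f wU[OF z, of s] that in \<open>auto simp: C1_holo_def\<close>)
      then show ?thesis
        unfolding k_def by (auto intro!: derivative_eq_intros)
    qed
    from fundamental_theorem_of_calculus[OF _ this] show ?thesis
      by (simp add: w_def)
  qed
  have "has_cderiv \<Phi> (f z) z" if z: "z \<in> U" for z
  proof -
    have "((\<lambda>x. integral (cbox 0 1) (\<lambda>s. (x - z0) \<odot> f (w x s))) has_derivative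
        integral (cbox 0 1) (\<lambda>s. sc_blinfun (k z s))) (at z within U)"
    proof (rule leibniz_rule[where fx = "\<lambda>x s. sc_blinfun (k x s)"])
      fix x and s :: real assume xs: "x \<in> U" "s \<in> cbox 0 1"
      have w': "((\<lambda>x. w x s) has_derivative (\<lambda>h. s *\<^sub>R h)) (at x within U)"
        unfolding w_def by (auto intro!: derivative_eq_intros)
      have "(f has_derivative (\<lambda>h. h \<odot> cderiv f (w x s))) (at (w x s))"
        using f wU[OF xs] by (auto simp: C1_holo_def has_cderiv_def)
      note has_derivative_compose[OF w' this]
      then have "((\<lambda>x. (x - z0) \<odot> f (w x s)) has_derivative
          (\<lambda>h. (x - z0) \<odot> (s *\<^sub>R h) \<odot> cderiv f (w x s) + h \<odot> f (w x s))) (at x within U)"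
        by (auto intro!: derivative_eq_intros FDERIV)
      moreover have "(\<lambda>h. (x - z0) \<odot> (s *\<^sub>R h) \<odot> cderiv f (w x s) + h \<odot> f (w x s))
          = blinfun_apply (sc_blinfun (k x s))"
        by (auto simp: k_def add_right scaleR_right scaleR_left sc_left_commute[of "x - z0"])
      ultimately show "((\<lambda>x. (x - z0) \<odot> f (w x s)) has_derivative
          blinfun_apply (sc_blinfun (k x s))) (at x within U)"
        by simp
    next
      fix x assume x: "x \<in> U"
      have "continuous_on (cbox 0 1) (\<lambda>s. f (w x s))"
        by (rule continuous_on_compose2[OF C1_holo_imp_continuous_on[OF f]])
          (use x in \<open>auto simp: w_def[symmetric] intro!: continuous_intros wU\<close>, auto simp: w_def intro!: continuous_intros)
      then show "(\<lambda>s. (x - z0) \<odot> f (w x s)) integrable_on cbox 0 1"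
        by (intro integrable_continuous continuous_on continuous_intros)
    next
      show "continuous_on (U \<times> cbox 0 1) (\<lambda>(x, s). sc_blinfun (k x s))"
        unfolding split_beta
        by (intro bounded_linear.continuous_on[OF bounded_linear_sc_blinfun] contk)
    qed (use z U in auto)
    moreover have "integral (cbox 0 1) (\<lambda>s. sc_blinfun (k z s)) = sc_blinfun (f z)"
      using has_integral_linear[OF k_int[OF z] bounded_linear_sc_blinfun]
      by (simp add: o_def integral_unique)
    ultimately show ?thesis
      using z U unfolding has_cderiv_def \<Phi>_def
      by (simp add: at_within_open[OF z] sc_blinfun_def bounded_linear_Blinfun_apply bounded_linear_left)
  qed
  then show ?thesis
    using that by blast
qed (use that in blast)

end

section \<open>Integration over polygonal chains\<close>

definition chain_support :: "(complex \<times> complex) list \<Rightarrow> complex set" where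
  "chain_support K = (\<Union>(a, b)\<in>set K. closed_segment a b)"

text \<open>The boundary of the chain, as a formal sum of points, vanishes. Counting end points with
  multiplicity avoids sorting the segments into closed polygons.\<close>

definition chain_closed :: "(complex \<times> complex) list \<Rightarrow> bool" where
  "chain_closed K \<longleftrightarrow> mset (map fst K) = mset (map snd K)"

lemma chain_support_simps [simp]:
  "chain_support [] = {}"
  "chain_support ((a, b) # K) = closed_segment a b \<union> chain_support K"
  "chain_support (K @ L) = chain_support K \<union> chain_support L"
  by (auto simp: chain_support_def)

lemma closed_chain_support: "closed (chain_support K)"
  unfolding chain_support_def by (intro closed_UN) auto

text \<open>Start points and end points form the same multiset, so the two sums of
  \<open>\<phi>\<close> cancel.\<close>

lemma chain_closed_sum_list:
  fixes \<phi> :: "complex \<Rightarrow> 'a::ab_group_add"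
  assumes "chain_closed K"
  shows "(\<Sum>(a, b)\<leftarrow>K. \<phi> b - \<phi> a) = 0"
proof -
  have "sum_list (map (\<phi> \<circ> fst) K) = sum_list (map (\<phi> \<circ> snd) K)"
    using assms unfolding chain_closed_def
    by (metis map_map mset_map sum_mset_sum_list)
  then show ?thesis
    by (simp add: case_prod_unfold sum_list_subtractf o_def)
qed

context complex_banach
begin

definition chain_int :: "(complex \<times> complex) list \<Rightarrow> (complex \<Rightarrow> 'e) \<Rightarrow> 'e" where
  "chain_int K f = (\<Sum>(a, b)\<leftarrow>K. integral {0..1} (\<lambda>s. (b - a) \<odot> f (linepath a b s)))"

lemma chain_int_simps [simp]:
  "chain_int [] f = 0"
  "chain_int ((a, b) # K) f = integral {0..1} (\<lambda>s. (b - a) \<odot> f (linepath a b s)) + chain_int K f"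
  "chain_int (K @ L) f = chain_int K f + chain_int L f"
  by (auto simp: chain_int_def)

lemma segment_integrable:
  assumes "continuous_on (closed_segment a b) f"
  shows "(\<lambda>s. (b - a) \<odot> f (linepath a b s)) integrable_on {0..1}"
proof -
  have "continuous_on {0..1} (\<lambda>s. f (linepath a b s))"
    by (rule continuous_on_compose2[OF assms]) (auto simp: linepath_in_path)
  then show ?thesis
    by (intro integrable_continuous_real continuous_on continuous_intros)
qed

lemma chain_int_cong:
  assumes "\<And>z. z \<in> chain_support K \<Longrightarrow> f z = g z"
  shows "chain_int K f = chain_int K g"
  using assms
proof (induction K)
  case (Cons p K)
  obtain a b where p: "p = (a, b)" by force
  have "integral {0..1} (\<lambda>s. (b - a) \<odot> f (linepath a b s))
      = integral {0..1} (\<lambda>s. (b - a) \<odot> g (linepath a b s))"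
    by (rule integral_cong) (use Cons.prems in \<open>auto simp: p linepath_in_path\<close>)
  then show ?case
    using Cons by (auto simp: p)
qed auto

lemma chain_int_add:
  assumes "continuous_on (chain_support K) f" "continuous_on (chain_support K) g"
  shows "chain_int K (\<lambda>z. f z + g z) = chain_int K f + chain_int K g"
  using assms
proof (induction K)
  case (Cons p K)
  obtain a b where p: "p = (a, b)" by force
  have "continuous_on (closed_segment a b) f" "continuous_on (closed_segment a b) g"
    "continuous_on (chain_support K) f" "continuous_on (chain_support K) g"
    using Cons.prems by (auto simp: p intro: continuous_on_subset)
  then show ?case
    using Cons.IH by (simp add: p add_right integral_add segment_integrable)
qed auto

text \<open>Complex linearity lets \<open>T\<close> pass the factors \<open>b - a\<close>;
  boundedness lets it pass the integrals.\<close>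

lemma chain_int_bounded_linear:
  assumes "bounded_linear T" "\<And>c x. T (c \<odot> x) = c \<odot> T x" "continuous_on (chain_support K) f"
  shows "chain_int K (\<lambda>z. T (f z)) = T (chain_int K f)"
  using assms(3)
proof (induction K)
  case Nil
  then show ?case
    by (simp add: linear_0 bounded_linear.linear assms(1))
next
  case (Cons p K)
  obtain a b where p: "p = (a, b)" by force
  have "continuous_on (closed_segment a b) f" "continuous_on (chain_support K) f"
    using Cons.prems by (auto simp: p intro: continuous_on_subset)
  then show ?case
    using Cons.IH integral_linear[OF segment_integrable[of a b f] assms(1)]
    by (simp add: p assms(2) o_def linear_add bounded_linear.linear assms(1))
qed

lemma chain_int_primitive:
  assumes "\<And>z. z \<in> chain_support K \<Longrightarrow> has_cderiv \<Phi> (f z) z"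
  shows "chain_int K f = (\<Sum>(a, b)\<leftarrow>K. \<Phi> b - \<Phi> a)"
  using assms
proof (induction K)
  case (Cons p K)
  obtain a b where p: "p = (a, b)" by force
  have "((\<lambda>s. \<Phi> (linepath a b s)) has_vector_derivative (b - a) \<odot> f (linepath a b s)) (at s within {0..1})"
    if "s \<in> {0..1}" for s
    by (rule has_cderiv_compose[OF Cons.prems has_vector_derivative_linepath_within])
      (use that in \<open>auto simp: p linepath_in_path\<close>)
  from fundamental_theorem_of_calculus[OF _ this]
  have "integral {0..1} (\<lambda>s. (b - a) \<odot> f (linepath a b s)) = \<Phi> b - \<Phi> a"
    by (simp add: integral_unique linepath_0' linepath_1')
  then show ?case
    using Cons by (simp add: p)
qed auto

lemma chain_int_closed_primitive:
  assumes "chain_closed K" "\<And>z. z \<in> chain_support K \<Longrightarrow> has_cderiv \<Phi> (f z) z"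
  shows "chain_int K f = 0"
  using chain_int_primitive[of K \<Phi> f] chain_closed_sum_list[of K \<Phi>] assms by simp

lemma continuous_on_chain_int:
  fixes h :: "'p::topological_space \<Rightarrow> complex \<Rightarrow> 'e"
  assumes "continuous_on (V \<times> chain_support K) (\<lambda>p. h (fst p) (snd p))"
  shows "continuous_on V (\<lambda>x. chain_int K (h x))"
  using assms
proof (induction K)
  case (Cons p K)
  obtain a b where p: "p = (a, b)" by force
  have ab: "continuous_on (V \<times> closed_segment a b) (\<lambda>p. h (fst p) (snd p))"
    and K: "continuous_on (V \<times> chain_support K) (\<lambda>p. h (fst p) (snd p))"
    using Cons.prems by (auto simp: p intro: continuous_on_subset)
  have "continuous_on (V \<times> cbox 0 1) (\<lambda>q. h (fst q) (linepath a b (snd q)))"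
  proof -
    have "continuous_on (V \<times> cbox 0 1) (\<lambda>q. (fst q, linepath a b (snd q)))"
      unfolding linepath_def by (intro continuous_intros)
    from continuous_on_compose2[OF ab this] show ?thesis
      by (simp add: image_subset_iff linepath_in_path)
  qed
  then have "continuous_on V (\<lambda>x. integral (cbox 0 1) (\<lambda>s. (b - a) \<odot> h x (linepath a b s)))"
    by (intro integral_continuous_on_param) (auto simp: split_beta intro!: continuous_on continuous_intros)
  then show ?case
    using Cons.IH[OF K] by (auto simp: p intro!: continuous_intros)
qed auto

section \<open>Cauchy transforms over chains\<close>

text \<open>Since \<open>1 / (l - w) - 1 / (l - z) = (w - z) / ((l - w) * (l - z))\<close>, the
  difference quotient is itself a chain integral, continuous in \<open>w\<close> off the
  chain.\<close>

lemma cauchy_transform_has_cderiv: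
  assumes f: "continuous_on (chain_support K) f" and z: "z \<notin> chain_support K"
  shows "has_cderiv (\<lambda>\<mu>. chain_int K (\<lambda>l. (1 / (l - \<mu>)) \<odot> f l))
    (chain_int K (\<lambda>l. (1 / ((l - z) * (l - z))) \<odot> f l)) z"
proof (rule has_cderiv_factorization
    [where V = "- chain_support K" and q = "\<lambda>w. chain_int K (\<lambda>l. (1 / ((l - w) * (l - z))) \<odot> f l)"])
  have fsnd: "continuous_on (X \<times> chain_support K) (\<lambda>p. f (snd p))" for X :: "complex set"
    by (rule continuous_on_compose2[OF f]) (auto intro!: continuous_intros)
  show "continuous_on (- chain_support K) (\<lambda>w. chain_int K (\<lambda>l. (1 / ((l - w) * (l - z))) \<odot> f l))"
    by (rule continuous_on_chain_int, intro continuous_on continuous_intros fsnd) (use z in auto)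
  fix w assume w: "w \<in> - chain_support K"
  have c: "continuous_on (chain_support K) (\<lambda>l. (1 / (l - \<mu>)) \<odot> f l)" if "\<mu> \<notin> chain_support K" for \<mu>
    by (intro continuous_on continuous_intros f) (use that in auto)
  have c2: "continuous_on (chain_support K) (\<lambda>l. (1 / ((l - w) * (l - z))) \<odot> f l)"
    by (intro continuous_on continuous_intros f) (use w z in auto)
  have "chain_int K (\<lambda>l. (1 / (l - w)) \<odot> f l)
      = chain_int K (\<lambda>l. (1 / (l - z)) \<odot> f l + (w - z) \<odot> (1 / ((l - w) * (l - z))) \<odot> f l)"
  proof (rule chain_int_cong)
    fix l assume "l \<in> chain_support K"
    then have "1 / (l - w) = 1 / (l - z) + (w - z) * (1 / ((l - w) * (l - z)))"
      using w z by (auto simp: divide_simps) 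
    then show "(1 / (l - w)) \<odot> f l = (1 / (l - z)) \<odot> f l + (w - z) \<odot> (1 / ((l - w) * (l - z))) \<odot> f l"
      by (metis add_left mult_sc)
  qed
  also have "\<dots> = chain_int K (\<lambda>l. (1 / (l - z)) \<odot> f l)
      + chain_int K (\<lambda>l. (w - z) \<odot> (1 / ((l - w) * (l - z))) \<odot> f l)"
    by (intro chain_int_add c z continuous_on continuous_on_const c2)
  also have "chain_int K (\<lambda>l. (w - z) \<odot> (1 / ((l - w) * (l - z))) \<odot> f l)
      = (w - z) \<odot> chain_int K (\<lambda>l. (1 / ((l - w) * (l - z))) \<odot> f l)"
    by (intro chain_int_bounded_linear bounded_linear_right sc_left_commute c2)
  finally show "chain_int K (\<lambda>l. (1 / (l - w)) \<odot> f l) - chain_int K (\<lambda>l. (1 / (l - z)) \<odot> f l)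
      = (w - z) \<odot> chain_int K (\<lambda>l. (1 / ((l - w) * (l - z))) \<odot> f l)"
    by simp
qed (use z closed_chain_support in auto)

lemma C1_holo_cauchy_transform:
  assumes f: "continuous_on (chain_support K) f"
  shows "C1_holo (\<lambda>\<mu>. chain_int K (\<lambda>l. (1 / (l - \<mu>)) \<odot> f l)) (- chain_support K)"
proof (rule C1_holoI)
  have fsnd: "continuous_on (X \<times> chain_support K) (\<lambda>p. f (snd p))" for X :: "complex set"
    by (rule continuous_on_compose2[OF f]) (auto intro!: continuous_intros)
  show "continuous_on (- chain_support K) (\<lambda>z. chain_int K (\<lambda>l. (1 / ((l - z) * (l - z))) \<odot> f l))"
    by (rule continuous_on_chain_int, intro continuous_on continuous_intros fsnd) auto
qed (use cauchy_transform_has_cderiv[OF f] in auto)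

lemma has_cderiv_field_derivative:
  assumes "(\<phi> has_field_derivative d) (at z)"
  shows "has_cderiv (\<lambda>z. \<phi> z \<odot> x) (d \<odot> x) z"
  using bounded_linear.has_derivative[OF bounded_linear_left assms[unfolded has_field_derivative_def], of x]
  by (simp add: has_cderiv_def mult_sc sc_left_commute[of d])

text \<open>The derivative in the pole \<open>y\<close> is the integral of
  \<open>1 / (l - y)^2\<close>, which has a primitive off \<open>y\<close> and so vanishes over a
  closed chain. Up to the factor 2 pi i this is the local constancy of winding numbers.\<close>

lemma winding_locally_constant:
  assumes K: "chain_closed K" and V: "convex V" "open V" "V \<inter> chain_support K = {}" "z \<in> V" "w \<in> V"
  shows "chain_int K (\<lambda>l. (1 / (l - z)) \<odot> x) = chain_int K (\<lambda>l. (1 / (l - w)) \<odot> x)"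
proof -
  have "((\<lambda>\<mu>. chain_int K (\<lambda>l. (1 / (l - \<mu>)) \<odot> x)) has_derivative (\<lambda>h. 0)) (at y within V)" if "y \<in> V" for y
  proof -
    have y: "y \<notin> chain_support K"
      using that V by auto
    have "chain_int K (\<lambda>l. (1 / ((l - y) * (l - y))) \<odot> x) = 0"
    proof (rule chain_int_closed_primitive[OF K, where \<Phi> = "\<lambda>l. (- 1 / (l - y)) \<odot> x"])
      fix l assume "l \<in> chain_support K"
      then show "has_cderiv (\<lambda>l. (- 1 / (l - y)) \<odot> x) ((1 / ((l - y) * (l - y))) \<odot> x) l"
        by (intro has_cderiv_field_derivative) (use y in \<open>auto intro!: derivative_eq_intros\<close>)
    qed
    with cauchy_transform_has_cderiv[OF continuous_on_const y, of x] show ?thesis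
      by (auto simp: has_cderiv_def zero_right intro: has_derivative_at_withinI)
  qed
  from has_derivative_zero_constant[OF V(1) this] V(4,5) show ?thesis
    by metis
qed

section \<open>Liouville's theorem\<close>

text \<open>Means over circles about 0 do not depend on the radius: in the coordinates
  \<open>exp (s + \<i> * t)\<close> the radial derivative is \<open>- \<i>\<close> times the angular
  one, which integrates to zero over a period. Small circles give \<open>G 0\<close> in the limit,
  large ones give 0.\<close>

lemma liouville_vanishing:
  assumes G: "C1_holo G UNIV" and lim: "(G \<longlongrightarrow> 0) at_infinity"
  shows "G 0 = 0"
proof -
  define e where "e s t = exp (of_real s + \<i> * of_real t)" for s t :: real
  define M where "M s = integral (cbox 0 (2 * pi)) (\<lambda>t. G (e s t))" for s
  have conte: "continuous_on X (\<lambda>p. e (fst p) (snd p))" for X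
    unfolding e_def by (intro continuous_intros)
  have contG: "continuous_on UNIV G" and contG': "continuous_on UNIV (cderiv G)"
    using G C1_holo_imp_continuous_on by (auto simp: C1_holo_def)
  have conte2: "continuous_on X (e s)" for X s
    unfolding e_def by (intro continuous_intros)
  have int: "(\<lambda>t. G (e s t)) integrable_on cbox 0 (2 * pi)" for s
    by (intro integrable_continuous continuous_on_compose2[OF contG conte2]) auto
  have "(M has_vector_derivative 0) (at s within UNIV)" for s
  proof -
    have D: "((\<lambda>s. integral (cbox 0 (2 * pi)) (\<lambda>t. G (e s t))) has_vector_derivative
        integral (cbox 0 (2 * pi)) (\<lambda>t. e s t \<odot> cderiv G (e s t))) (at s within UNIV)"
    proof (rule leibniz_rule_vector_derivative)
      fix s t
      have "((\<lambda>s. e s t) has_vector_derivative e s t) (at s)"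
        unfolding e_def by (rule has_vector_derivative_real_field) (auto intro!: derivative_eq_intros)
      then show "((\<lambda>s. G (e s t)) has_vector_derivative e s t \<odot> cderiv G (e s t)) (at s within UNIV)"
        by (intro has_cderiv_compose) (use G in \<open>auto simp: C1_holo_def\<close>)
    next
      show "continuous_on (UNIV \<times> cbox 0 (2 * pi)) (\<lambda>(s, t). e s t \<odot> cderiv G (e s t))"
        unfolding split_beta
        by (intro continuous_on conte continuous_on_compose2[OF contG' conte]) auto
    qed (use int in auto)
    have "((\<lambda>t. (\<i> * e s t) \<odot> cderiv G (e s t)) has_integral (G (e s (2 * pi)) - G (e s 0))) (cbox 0 (2 * pi))"
      unfolding box_real
    proof (rule fundamental_theorem_of_calculus)
      fix t
      have "(e s has_vector_derivative \<i> * e s t) (at t within {0..2 * pi})"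
        unfolding e_def by (rule has_vector_derivative_real_field) (auto intro!: derivative_eq_intros)
      then show "((\<lambda>t. G (e s t)) has_vector_derivative (\<i> * e s t) \<odot> cderiv G (e s t)) (at t within {0..2 * pi})"
        by (intro has_cderiv_compose) (use G in \<open>auto simp: C1_holo_def\<close>)
    qed auto
    moreover have "e s (2 * pi) = e s 0"
      by (simp add: e_def exp_add mult.commute[of \<i>])
    ultimately have "((\<lambda>t. (\<i> * e s t) \<odot> cderiv G (e s t)) has_integral 0) (cbox 0 (2 * pi))"
      by simp
    from has_integral_linear[OF this bounded_linear_right[of "- \<i>"]]
    have "((\<lambda>t. e s t \<odot> cderiv G (e s t)) has_integral 0) (cbox 0 (2 * pi))"
      by (simp add: o_def zero_right mult_sc[symmetric])
    with D show ?thesis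
      unfolding M_def by (simp add: integral_unique)
  qed
  then obtain m where m: "\<And>s. M s = m"
    using has_vector_derivative_zero_constant[of UNIV M] by auto
  \<comment> \<open>If \<open>G\<close> stays close to \<open>c\<close> on one circle, then so does
    the common mean \<open>m / (2 * pi)\<close>. This is applied with \<open>c = 0\<close> on a
    large circle and \<open>c = G 0\<close> on a small one.\<close>
  have near: "norm (m - (2 * pi) *\<^sub>R c) \<le> \<epsilon> * (2 * pi)"
    if "\<epsilon> > 0" and bd: "\<And>z. norm z = exp s \<Longrightarrow> norm (G z - c) \<le> \<epsilon>" for c \<epsilon> s
  proof -
    have "((\<lambda>t. G (e s t) - c) has_integral (m - (2 * pi) *\<^sub>R c)) (cbox 0 (2 * pi))"
      using has_integral_diff[OF integrable_integral[OF int[of s]] has_integral_const[of c 0 "2 * pi"]]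
      by (simp add: M_def[unfolded box_real, symmetric] m)
    from has_integral_bound[OF _ this] have "norm (m - (2 * pi) *\<^sub>R c) \<le> \<epsilon> * measure lborel (cbox 0 (2 * pi))"
      using that by (auto simp: e_def intro!: bd)
    then show ?thesis by simp
  qed
  have "norm (G 0) \<le> 2 * \<epsilon>" if \<epsilon>: "\<epsilon> > 0" for \<epsilon>
  proof -
    obtain B where B: "\<And>z. norm z \<ge> B \<Longrightarrow> norm (G z) < \<epsilon>"
      using lim \<epsilon> by (auto simp: Lim_at_infinity)
    obtain d where d: "d > 0" "\<And>z. norm z < d \<Longrightarrow> norm (G z - G 0) < \<epsilon>"
      using contG \<epsilon> unfolding continuous_on_iff dist_norm by (metis UNIV_I diff_zero)
    have "norm (m - (2 * pi) *\<^sub>R 0) \<le> \<epsilon> * (2 * pi)"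
    proof (rule near[OF \<epsilon>])
      fix z :: complex assume "norm z = exp (ln (max B 1))"
      then show "norm (G z - 0) \<le> \<epsilon>"
        using B[of z] by auto
    qed
    moreover have "norm (m - (2 * pi) *\<^sub>R G 0) \<le> \<epsilon> * (2 * pi)"
    proof (rule near[OF \<epsilon>])
      fix z :: complex assume "norm z = exp (ln (d / 2))"
      then show "norm (G z - G 0) \<le> \<epsilon>"
        using d(1) d(2)[of z] by auto
    qed
    ultimately have "norm (m - (m - (2 * pi) *\<^sub>R G 0)) \<le> \<epsilon> * (2 * pi) + \<epsilon> * (2 * pi)"
      using norm_triangle_ineq4[of m "m - (2 * pi) *\<^sub>R G 0"] by (simp only: scaleR_zero_right diff_zero)
    then have "(2 * pi) * norm (G 0) \<le> (2 * pi) * (2 * \<epsilon>)"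
      by simp
    then show ?thesis
      by (rule mult_left_le_imp_le) simp
  qed
  \<comment> \<open>With this choice the norm of \<open>G 0\<close> is at most two thirds of
    itself.\<close>
  from this[of "norm (G 0) / 3"] show ?thesis
    by (cases "G 0 = 0") auto
qed

end

context complex_banach
begin

text \<open>A valid path need not be rectifiable: its derivative may be unbounded near the exceptional
  points. Only integrands with local primitives can therefore be integrated along it, and comparing
  primitives replaces it by a polygon that serves all of them at once.\<close>
lemma valid_path_polygonal_chain:
  assumes g: "valid_path g" "path_image g \<subseteq> U" "open U"
  obtains K where "chain_support K \<subseteq> U"
    "add_mset (g 1) (mset (map fst K)) = add_mset (g 0) (mset (map snd K))"
    "\<And>f. C1_holo f U \<Longrightarrow>
      ((\<lambda>t. vector_derivative g (at t within {0..1}) \<odot> f (g t)) has_integral chain_int K f) {0..1}"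
proof -
  have contg: "continuous_on {0..1} g"
    using g(1) by (simp add: valid_path_def piecewise_C1_differentiable_on_def)
  obtain S where S: "finite S" "g C1_differentiable_on ({0..1} - S)"
    using g(1) by (auto simp: valid_path_def piecewise_C1_differentiable_on_def)
  have "compact (path_image g)"
    using g(1) by (simp add: compact_path_image valid_path_imp_path)
  \<comment> \<open>By compactness one radius serves all points of the path.\<close>
  then obtain e where e: "e > 0" "(\<Union>x\<in>path_image g. ball x e) \<subseteq> U"
    using compact_subset_open_imp_ball_epsilon_subset g(2,3) by metis
  have "uniformly_continuous_on {0..1} g"
    using contg by (simp add: compact_uniformly_continuous)
  then obtain d where d: "d > 0"
    "\<And>s t. \<lbrakk>s \<in> {0..1}; t \<in> {0..1}; dist t s < d\<rbrakk> \<Longrightarrow> dist (g t) (g s) < e"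
    using e(1) unfolding uniformly_continuous_on_def by metis
  \<comment> \<open>The unit interval is cut into pieces so short that the path stays, on each of
    them, in the ball of radius \<open>e\<close> about its initial point; primitives exist on these
    balls.\<close>
  obtain n' where n': "1 / real (Suc n') < d"
    using d(1) nat_approx_posE by metis
  define n where "n = Suc n'"
  have n: "n > 0" "1 / real n < d"
    using n' by (auto simp: n_def)
  define p where "p i = g (real i / real n)" for i
  have in01: "t \<in> {0..1}" if "i < n" "t \<in> {real i / n .. real (Suc i) / n}" for i t
  proof -
    have "real (Suc i) / n \<le> 1"
      using that(1) by (simp add: divide_simps)
    moreover have "0 \<le> real i / n"
      by simp
    ultimately show ?thesis
      using that(2) by (meson atLeastAtMost_iff order_trans)
  qed
  have step: "real (Suc i) / n = real i / n + 1 / n" for i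
    by (simp add: add_divide_distrib)
  have piece: "g t \<in> ball (p i) e" if "i < n" "t \<in> {real i / n .. real (Suc i) / n}" for i t
  proof -
    have "dist (real i / n) t < d"
      using that(2) n(2) step[of i] unfolding dist_real_def by auto
    then show ?thesis
      unfolding p_def mem_ball using that in01[of i] by (intro d(2)) (auto simp: step)
  qed
  have ballU: "ball (p i) e \<subseteq> U" if "i < n" for i
  proof -
    have "p i \<in> path_image g"
      unfolding p_def path_image_def using that by (intro imageI) auto
    then show ?thesis
      using e(2) by blast
  qed
  have p_Suc: "p (Suc i) \<in> ball (p i) e" if "i < n" for i
    using piece[OF that, of "real (Suc i) / n"] by (simp add: p_def divide_right_mono)
  have seg: "closed_segment (p i) (p (Suc i)) \<subseteq> ball (p i) e" if "i < n" for i
    using p_Suc[OF that] e(1) by (intro closed_segment_subset) auto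
  define K where "K m = map (\<lambda>i. (p i, p (Suc i))) [0..<m]" for m
  have supp: "chain_support (K m) \<subseteq> U" if "m \<le> n" for m
  proof
    fix z assume "z \<in> chain_support (K m)"
    then obtain i where "i < m" "z \<in> closed_segment (p i) (p (Suc i))"
      by (auto simp: K_def chain_support_def)
    then show "z \<in> U"
      using seg[of i] ballU[of i] that by auto
  qed
  \<comment> \<open>The boundary of the polygon is \<open>p m\<close> minus \<open>p 0\<close>,
    written without subtraction by adding each point to the opposite side.\<close>
  have ends: "add_mset (p m) (mset (map fst (K m))) = add_mset (p 0) (mset (map snd (K m)))" for m
    by (induction m) (auto simp: K_def add_mset_commute)
  have "((\<lambda>t. vector_derivative g (at t within {0..1}) \<odot> f (g t)) has_integral chain_int (K m) f)
      {0..real m / n}" if f: "C1_holo f U" and "m \<le> n" for f m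
    using that(2)
  proof (induction m)
    case 0
    then show ?case by (simp add: K_def has_integral_refl)
  next
    case (Suc m)
    then have m: "m < n" by simp
    \<comment> \<open>One primitive on the ball evaluates both the integral along this piece of the
      path and the integral along its chord, by the same difference of end values.\<close>
    obtain \<Phi> where \<Phi>: "\<And>z. z \<in> ball (p m) e \<Longrightarrow> has_cderiv \<Phi> (f z) z"
      using C1_holo_primitive[OF C1_holo_subset[OF f ballU[OF m]]] by auto
    have "((\<lambda>t. vector_derivative g (at t within {0..1}) \<odot> f (g t)) has_integral
        (\<Phi> (g (real (Suc m) / n)) - \<Phi> (g (real m / n)))) {real m / n .. real (Suc m) / n}"
    \<comment> \<open>At the finitely many points of \<open>S\<close> this form of the fundamental
      theorem asks only for continuity of the primitive along the path, so a blow-up of the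
      derivative there does no harm.\<close>
    proof (rule fundamental_theorem_of_calculus_interior_strong[OF S(1)])
      show "real m / n \<le> real (Suc m) / n"
        by (simp add: divide_right_mono)
      have "continuous_on (ball (p m) e) \<Phi>"
        using \<Phi> unfolding has_cderiv_def
        by (meson continuous_at_imp_continuous_on has_derivative_continuous)
      moreover have "continuous_on {real m / n .. real (Suc m) / n} g"
        by (rule continuous_on_subset[OF contg]) (use in01[OF m] in blast)
      ultimately show "continuous_on {real m / n .. real (Suc m) / n} (\<lambda>t. \<Phi> (g t))"
        by (rule continuous_on_compose2) (use piece[OF m] in blast)
      fix t assume t: "t \<in> {real m / n <..< real (Suc m) / n} - S"
      have "real m / n \<in> {0..1}" "real (Suc m) / n \<in> {0..1}"
        using m by (auto simp: divide_simps)
      then have t01: "t \<in> {0<..<1}"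
        using t by (metis DiffD1 atLeastAtMost_iff greaterThanLessThan_iff le_less_trans less_le_trans)
      then have "(g has_vector_derivative vector_derivative g (at t)) (at t)"
        using S(2) t unfolding C1_differentiable_on_eq vector_derivative_works by auto
      moreover have "vector_derivative g (at t within {0..1}) = vector_derivative g (at t)"
        using t01 by (simp add: at_within_Icc_at)
      ultimately show "((\<lambda>t. \<Phi> (g t)) has_vector_derivative
          vector_derivative g (at t within {0..1}) \<odot> f (g t)) (at t)"
        using t piece[OF m, of t] by (intro has_cderiv_compose \<Phi>) auto
    qed
    moreover have "chain_int [(p m, p (Suc m))] f = \<Phi> (p (Suc m)) - \<Phi> (p m)"
      by (subst chain_int_primitive[of _ \<Phi>]) (use \<Phi> seg[OF m] in auto)
    then have "chain_int (K (Suc m)) f = chain_int (K m) f + (\<Phi> (p (Suc m)) - \<Phi> (p m))"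
      by (simp add: K_def)
    ultimately show ?case
      using has_integral_combine[OF _ _ Suc.IH] m by (simp add: p_def divide_right_mono)
  qed
  from this[of _ n] supp[of n] ends[of n] n(1) show ?thesis
    by (intro that[of "K n"]) (auto simp: p_def)
qed

end

section \<open>The resolvent\<close>

lemmas comp_bilinear_simps =
  bounded_bilinear.add_left[OF bounded_bilinear_blinfun_compose]
  bounded_bilinear.add_right[OF bounded_bilinear_blinfun_compose]
  bounded_bilinear.diff_left[OF bounded_bilinear_blinfun_compose]
  bounded_bilinear.diff_right[OF bounded_bilinear_blinfun_compose]
  bounded_bilinear.minus_left[OF bounded_bilinear_blinfun_compose]
  bounded_bilinear.minus_right[OF bounded_bilinear_blinfun_compose]
  bounded_bilinear.scaleR_left[OF bounded_bilinear_blinfun_compose]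
  bounded_bilinear.scaleR_right[OF bounded_bilinear_blinfun_compose]

lemma comp_assoc: "(S o\<^sub>L T) o\<^sub>L U = S o\<^sub>L (T o\<^sub>L U)"
  by (rule blinfun_eqI) simp

lemma comp_id [simp]: "id_blinfun o\<^sub>L T = T" "T o\<^sub>L id_blinfun = T"
  by (auto intro: blinfun_eqI)

text \<open>Banach's fixed point theorem replaces the series: the fixed point of
  \<open>1 + S X\<close> is a right inverse, that of \<open>1 + X S\<close> a left inverse, and
  associativity makes them equal.\<close>

lemma neumann_inverse:
  fixes S :: "'x::banach \<Rightarrow>\<^sub>L 'x"
  assumes "norm S < 1"
  obtains Y where "(id_blinfun - S) o\<^sub>L Y = id_blinfun" "Y o\<^sub>L (id_blinfun - S) = id_blinfun"
proof -
  have "dist (id_blinfun + (S o\<^sub>L X)) (id_blinfun + (S o\<^sub>L Y)) \<le> norm S * dist X Y" for X Y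
    using norm_blinfun_compose[of S "X - Y"] by (simp add: dist_norm comp_bilinear_simps)
  then obtain Y where Y: "id_blinfun + (S o\<^sub>L Y) = Y"
    using banach_fix_type[of "norm S" "\<lambda>X. id_blinfun + (S o\<^sub>L X)"] assms by auto
  have "dist (id_blinfun + (X o\<^sub>L S)) (id_blinfun + (Y o\<^sub>L S)) \<le> norm S * dist X Y" for X Y
    using norm_blinfun_compose[of "X - Y" S] by (simp add: dist_norm comp_bilinear_simps mult.commute)
  then obtain Z where Z: "id_blinfun + (Z o\<^sub>L S) = Z"
    using banach_fix_type[of "norm S" "\<lambda>X. id_blinfun + (X o\<^sub>L S)"] assms by auto
  have Y': "(id_blinfun - S) o\<^sub>L Y = id_blinfun"
    using Y by (simp add: comp_bilinear_simps algebra_simps)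
  have Z': "Z o\<^sub>L (id_blinfun - S) = id_blinfun"
    using Z by (simp add: comp_bilinear_simps algebra_simps)
  have "Z = Y"
    by (metis Y' Z' comp_assoc comp_id)
  with Y' Z' that show ?thesis
    by blast
qed

lemma BX_closed [intro]:
  "S \<in> BX J \<Longrightarrow> T \<in> BX J \<Longrightarrow> S + T \<in> BX J"
  "S \<in> BX J \<Longrightarrow> T \<in> BX J \<Longrightarrow> S - T \<in> BX J"
  "S \<in> BX J \<Longrightarrow> T \<in> BX J \<Longrightarrow> S o\<^sub>L T \<in> BX J"
  "S \<in> BX J \<Longrightarrow> - S \<in> BX J"
  "id_blinfun \<in> BX J"
  "cI J c \<in> BX J"
proof -
  show "S o\<^sub>L T \<in> BX J" if "S \<in> BX J" "T \<in> BX J"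
    using that comp_assoc[of S J T] comp_assoc[of J S T] by (simp add: BX_def comp_assoc)
qed (auto simp: BX_def cI_def comp_bilinear_simps)

text \<open>In product notation, \<open>S J = S (J T) S = S (T J) S = J S\<close>.\<close>

lemma BX_inverse:
  assumes "T \<in> BX J" "S o\<^sub>L T = id_blinfun" "T o\<^sub>L S = id_blinfun"
  shows "S \<in> BX J"
proof -
  have "S o\<^sub>L J = S o\<^sub>L (J o\<^sub>L T) o\<^sub>L S"
    by (simp add: comp_assoc assms(3))
  also have "\<dots> = (S o\<^sub>L T) o\<^sub>L J o\<^sub>L S"
    using assms(1) by (simp add: BX_def comp_assoc)
  finally show ?thesis
    by (simp add: BX_def assms(2))
qed

lemma BX_commute_cI: "T \<in> BX J \<Longrightarrow> cI J c o\<^sub>L T = T o\<^sub>L cI J c"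
  by (simp add: BX_def cI_def comp_bilinear_simps)

lemma cI_0 [simp]: "cI J 0 = 0" and cI_1 [simp]: "cI J 1 = id_blinfun"
  by (auto simp: cI_def)

lemma cI_linear:
  "cI J (a + b) = cI J a + cI J b" "cI J (a - b) = cI J a - cI J b" "cI J (- a) = - cI J a"
  by (auto simp: cI_def algebra_simps)

lemma invertible_op_compose:
  assumes "invertible_op J S" "invertible_op J T"
  shows "invertible_op J (S o\<^sub>L T)"
proof -
  obtain S' T' where "S' \<in> BX J" "S' o\<^sub>L S = id_blinfun" "S o\<^sub>L S' = id_blinfun"
    "T' \<in> BX J" "T' o\<^sub>L T = id_blinfun" "T o\<^sub>L T' = id_blinfun"
    using assms unfolding invertible_op_def by metis
  moreover have "(T' o\<^sub>L S') o\<^sub>L (S o\<^sub>L T) = T' o\<^sub>L ((S' o\<^sub>L S) o\<^sub>L T)"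
    "(S o\<^sub>L T) o\<^sub>L (T' o\<^sub>L S') = S o\<^sub>L ((T o\<^sub>L T') o\<^sub>L S')"
    by (simp_all only: comp_assoc)
  ultimately show ?thesis
    unfolding invertible_op_def by (intro bexI[of _ "T' o\<^sub>L S'"]) auto
qed

lemma invertible_op_neumann:
  assumes "S \<in> BX J" "norm S < 1"
  shows "invertible_op J (id_blinfun - S)"
proof -
  obtain Y where "(id_blinfun - S) o\<^sub>L Y = id_blinfun" "Y o\<^sub>L (id_blinfun - S) = id_blinfun"
    using neumann_inverse[OF assms(2)] by metis
  then show ?thesis
    using BX_inverse[of "id_blinfun - S" J Y] assms(1) unfolding invertible_op_def by blast
qed

section \<open>Resolvent set and resolvent of a fixed operator\<close>

locale complex_operator =
  fixes J A :: "'x::banach \<Rightarrow>\<^sub>L 'x"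
  assumes J: "complex_structure J" and A: "A \<in> BX J"
begin

lemma cI_apply: "blinfun_apply (cI J c) x = cscale J c x"
  by (simp add: cI_def cscale_def blinfun.bilinear_simps)

lemma norm_cI_apply: "norm (blinfun_apply (cI J c) x) = cmod c * norm x"
  using J by (simp add: cI_apply complex_structure_def)

lemma norm_cI_le: "norm (cI J c) \<le> cmod c"
  by (rule norm_blinfun_bound) (auto simp: norm_cI_apply)

lemma cI_mult: "cI J (a * b) = cI J a o\<^sub>L cI J b"
proof -
  have "J o\<^sub>L J = - id_blinfun"
    using J by (intro blinfun_eqI) (simp add: complex_structure_def blinfun.bilinear_simps)
  then show ?thesis
    by (simp add: cI_def comp_bilinear_simps algebra_simps)
qed

lemma bounded_linear_cI: "bounded_linear (cI J)"
  by (rule bounded_linear_intro[where K = 1])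
    (auto simp: norm_cI_le cI_linear, simp add: cI_def algebra_simps)

lemma norm_comp_cI_le: "norm (T o\<^sub>L cI J c) \<le> cmod c * norm T"
  by (metis mult.commute mult_right_mono norm_blinfun_compose norm_cI_le norm_ge_zero order_trans)

text \<open>Scalars act by composition on the right, to match the integrand of
  \<open>op_contour_integral\<close>. The action covers all bounded real-linear operators, where
  left and right composition with \<open>cI J c\<close> may differ.\<close>

sublocale complex_banach "\<lambda>c (T :: 'x \<Rightarrow>\<^sub>L 'x). T o\<^sub>L cI J c"
proof (unfold_locales)
  show "T o\<^sub>L cI J (a * b) = (T o\<^sub>L cI J b) o\<^sub>L cI J a" for a b and T :: "'x \<Rightarrow>\<^sub>L 'x"
    by (metis cI_mult comp_assoc mult.commute)
  show "\<exists>K. \<forall>a (T :: 'x \<Rightarrow>\<^sub>L 'x). norm (T o\<^sub>L cI J a) \<le> norm a * norm T * K"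
    using norm_comp_cI_le by (intro exI[of _ 1]) auto
qed (auto simp: comp_bilinear_simps cI_def algebra_simps)

lemma resolvent:
  assumes "l \<notin> op_spectrum J A"
  shows resolvent_in_BX: "resolvent J A l \<in> BX J"
    and resolvent_left: "resolvent J A l o\<^sub>L (A - cI J l) = id_blinfun"
    and resolvent_right: "(A - cI J l) o\<^sub>L resolvent J A l = id_blinfun"
proof -
  have "\<exists>!S. S \<in> BX J \<and> S o\<^sub>L (A - cI J l) = id_blinfun \<and> (A - cI J l) o\<^sub>L S = id_blinfun"
  proof (rule ex_ex1I)
    show "\<exists>S. S \<in> BX J \<and> S o\<^sub>L (A - cI J l) = id_blinfun \<and> (A - cI J l) o\<^sub>L S = id_blinfun"
      using assms unfolding op_spectrum_def invertible_op_def by blast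
    show "S = T" if "S \<in> BX J \<and> S o\<^sub>L (A - cI J l) = id_blinfun \<and> (A - cI J l) o\<^sub>L S = id_blinfun"
      "T \<in> BX J \<and> T o\<^sub>L (A - cI J l) = id_blinfun \<and> (A - cI J l) o\<^sub>L T = id_blinfun" for S T
      using comp_assoc[of S "A - cI J l" T] that by simp
  qed
  from theI'[OF this] show "resolvent J A l \<in> BX J"
    "resolvent J A l o\<^sub>L (A - cI J l) = id_blinfun"
    "(A - cI J l) o\<^sub>L resolvent J A l = id_blinfun"
    unfolding resolvent_def by blast+
qed

lemma resolvent_commute:
  assumes "l \<notin> op_spectrum J A" "M \<in> BX J" "M o\<^sub>L A = A o\<^sub>L M"
  shows "M o\<^sub>L resolvent J A l = resolvent J A l o\<^sub>L M"
proof -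
  have "M o\<^sub>L (A - cI J l) = (A - cI J l) o\<^sub>L M"
    using assms by (simp add: comp_bilinear_simps BX_commute_cI)
  then show ?thesis
    using resolvent_left[OF assms(1)] resolvent_right[OF assms(1)] by (metis comp_assoc comp_id)
qed

text \<open>Insert the identities \<open>(A - w) R_w\<close> and \<open>R_z (A - z)\<close> into the
  difference; the middle factors then differ by the scalar \<open>z - w\<close>.\<close>

lemma resolvent_identity:
  assumes "z \<notin> op_spectrum J A" "w \<notin> op_spectrum J A"
  shows "resolvent J A z - resolvent J A w
    = (resolvent J A z o\<^sub>L resolvent J A w) o\<^sub>L cI J (z - w)"
proof -
  let ?R = "resolvent J A"
  have "?R z - ?R w = (?R z o\<^sub>L ((A - cI J w) o\<^sub>L ?R w)) - ((?R z o\<^sub>L (A - cI J z)) o\<^sub>L ?R w)"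
    using assms by (simp add: resolvent_right resolvent_left)
  also have "\<dots> = ?R z o\<^sub>L (((A - cI J w) - (A - cI J z)) o\<^sub>L ?R w)"
    by (simp only: comp_assoc comp_bilinear_simps(3,4))
  also have "(A - cI J w) - (A - cI J z) = cI J (z - w)"
    by (simp add: cI_linear)
  finally show ?thesis
    by (simp only: comp_assoc BX_commute_cI[OF resolvent_in_BX[OF assms(2)]])
qed

text \<open>In product notation \<open>A - z = (A - w) (1 - R_w (z - w))\<close>, and the last
  factor has a Neumann inverse for \<open>z\<close> near \<open>w\<close>. The summand 1 in the
  radius keeps its denominator positive.\<close>

lemma open_resolvent_set: "open (- op_spectrum J A)"
  unfolding open_dist
proof safe
  fix w assume w: "w \<notin> op_spectrum J A"
  let ?R = "resolvent J A w"
  have "z \<notin> op_spectrum J A" if z: "dist z w < 1 / (norm ?R + 1)" for z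
  proof -
    have "cmod (z - w) * (norm ?R + 1) < 1"
      using z by (simp add: dist_norm pos_less_divide_eq add_nonneg_pos)
    then have "cmod (z - w) * norm ?R < 1"
      by (smt (verit) mult_left_mono norm_ge_zero)
    then have "norm (?R o\<^sub>L cI J (z - w)) < 1"
      using norm_comp_cI_le order_le_less_trans by blast
    then have "invertible_op J (id_blinfun - (?R o\<^sub>L cI J (z - w)))"
      using resolvent_in_BX[OF w] by (intro invertible_op_neumann) auto
    moreover have "invertible_op J (A - cI J w)"
      using w by (simp add: op_spectrum_def)
    moreover have "(A - cI J w) o\<^sub>L (id_blinfun - (?R o\<^sub>L cI J (z - w))) = A - cI J z"
      unfolding comp_bilinear_simps(4) by (simp add: comp_assoc[symmetric] resolvent_right[OF w] cI_linear)
    ultimately show ?thesis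
      using invertible_op_compose unfolding op_spectrum_def by fastforce
  qed
  then show "\<exists>e>0. \<forall>z. dist z w < e \<longrightarrow> z \<in> - op_spectrum J A"
    by (intro exI[of _ "1 / (norm ?R + 1)"]) (auto simp: add_nonneg_pos)
qed

text \<open>The resolvent identity bounds the difference by \<open>|z - w| |R_z| |R_w|\<close>. Once
  \<open>|z - w| |R_w| < 1/2\<close>, it also forces \<open>|R_z| \<le> 2 |R_w|\<close>, so the
  bound tends to zero.\<close>

lemma continuous_on_resolvent: "continuous_on (- op_spectrum J A) (resolvent J A)"
proof -
  let ?R = "resolvent J A"
  have "isCont ?R w" if w: "w \<in> - op_spectrum J A" for w
  proof -
    let ?r = "norm (?R w)"
    have le: "norm (?R z - ?R w) \<le> cmod (z - w) * (norm (?R z) * ?r)" if "z \<notin> op_spectrum J A" for z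
    proof -
      have "norm (?R z - ?R w) \<le> cmod (z - w) * norm (?R z o\<^sub>L ?R w)"
        using that w norm_comp_cI_le by (simp add: resolvent_identity)
      also have "\<dots> \<le> cmod (z - w) * (norm (?R z) * ?r)"
        by (intro mult_left_mono norm_blinfun_compose) auto
      finally show ?thesis .
    qed
    have "\<forall>\<^sub>F z in at w. z \<in> - op_spectrum J A"
      using open_resolvent_set w by (rule eventually_at_in_open')
    moreover have "\<forall>\<^sub>F z in at w. cmod (z - w) * ?r < 1 / 2"
    proof (rule order_tendstoD)
      have "((\<lambda>z. cmod (z - w) * ?r) \<longlongrightarrow> cmod (w - w) * ?r) (at w)"
        by (intro tendsto_intros)
      then show "((\<lambda>z. cmod (z - w) * ?r) \<longlongrightarrow> 0) (at w)"
        by simp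
    qed simp
    ultimately have bound: "\<forall>\<^sub>F z in at w. norm (?R z - ?R w) \<le> cmod (z - w) * (2 * ?r * ?r)"
    proof eventually_elim
      case (elim z)
      have "norm (?R z) \<le> ?r + norm (?R z - ?R w)"
        by norm
      also have "norm (?R z - ?R w) \<le> (cmod (z - w) * ?r) * norm (?R z)"
        using le[of z] elim by (simp add: ac_simps)
      also have "\<dots> \<le> 1 / 2 * norm (?R z)"
        using elim by (intro mult_right_mono) auto
      finally have "norm (?R z) \<le> 2 * ?r"
        by simp
      then have "cmod (z - w) * (norm (?R z) * ?r) \<le> cmod (z - w) * (2 * ?r * ?r)"
        by (intro mult_left_mono mult_right_mono) auto
      with le[of z] elim show ?case
        by simp
    qed
    have "((\<lambda>z. cmod (z - w) * (2 * ?r * ?r)) \<longlongrightarrow> cmod (w - w) * (2 * ?r * ?r)) (at w)"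
      by (intro tendsto_intros)
    then have "((\<lambda>z. cmod (z - w) * (2 * ?r * ?r)) \<longlongrightarrow> 0) (at w)"
      by simp
    with bound have "((\<lambda>z. ?R z - ?R w) \<longlongrightarrow> 0) (at w)"
      by (rule Lim_null_comparison)
    then show ?thesis
      by (simp add: isCont_def LIM_zero_iff)
  qed
  then show ?thesis
    by (blast intro: continuous_at_imp_continuous_on)
qed

text \<open>The resolvent identity is already a Caratheodory factorization, with quotient
  \<open>R_z R_w\<close>; hence the derivative at \<open>w\<close> is the square of
  \<open>R_w\<close>.\<close>

lemma C1_holo_resolvent: "C1_holo (resolvent J A) (- op_spectrum J A)"
proof (rule C1_holoI)
  let ?R = "resolvent J A"
  note cont = continuous_on_resolvent bounded_bilinear.continuous_on[OF bounded_bilinear_blinfun_compose]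
  show "continuous_on (- op_spectrum J A) (\<lambda>z. ?R z o\<^sub>L ?R z)"
    by (intro cont)
  fix w assume w: "w \<in> - op_spectrum J A"
  show "has_cderiv ?R (?R w o\<^sub>L ?R w) w"
    by (rule has_cderiv_factorization[OF open_resolvent_set w, where q = "\<lambda>z. ?R z o\<^sub>L ?R w"])
      (use w in \<open>auto simp: resolvent_identity intro!: cont continuous_on_const\<close>)
qed

text \<open>Invertibility comes from \<open>A - z = (1 - A / z) (- z)\<close> and Neumann inversion.
  The estimate comes from \<open>R_z z = R_z A - 1\<close>, which bounds \<open>|R_z| |z|\<close> by
  \<open>|R_z| |A| + 1\<close>.\<close>

lemma large_not_in_spectrum:
  assumes "cmod z > norm A"
  shows "z \<notin> op_spectrum J A" "norm (resolvent J A z) \<le> 1 / (cmod z - norm A)"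
proof -
  have z: "z \<noteq> 0"
    using assms by auto
  have "norm (A o\<^sub>L cI J (1 / z)) < 1"
  proof -
    have "norm (A o\<^sub>L cI J (1 / z)) \<le> norm A / cmod z"
      using norm_comp_cI_le[of A "1 / z"] by (simp add: norm_divide)
    also have "\<dots> < 1"
      using assms z by simp
    finally show ?thesis .
  qed
  then have "invertible_op J (id_blinfun - (A o\<^sub>L cI J (1 / z)))"
    using A by (intro invertible_op_neumann) auto
  moreover have "invertible_op J (cI J (- z))"
    unfolding invertible_op_def using z
    by (intro bexI[of _ "cI J (- 1 / z)"]) (auto simp: cI_mult[symmetric])
  moreover have "(id_blinfun - (A o\<^sub>L cI J (1 / z))) o\<^sub>L cI J (- z) = A - cI J z"
    using z by (simp add: comp_bilinear_simps comp_assoc cI_mult[symmetric] cI_linear)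
  ultimately show z': "z \<notin> op_spectrum J A"
    using invertible_op_compose unfolding op_spectrum_def by fastforce
  let ?R = "resolvent J A z"
  have "?R o\<^sub>L cI J z = (?R o\<^sub>L A) - id_blinfun"
    using resolvent_left[OF z'] by (simp add: comp_bilinear_simps algebra_simps)
  then have "?R = ((?R o\<^sub>L A) - id_blinfun) o\<^sub>L cI J (1 / z)"
    using z by (simp add: comp_assoc cI_mult[symmetric] flip: \<open>?R o\<^sub>L cI J z = (?R o\<^sub>L A) - id_blinfun\<close>)
  then have "norm ?R \<le> cmod (1 / z) * norm ((?R o\<^sub>L A) - id_blinfun)"
    using norm_comp_cI_le by metis
  also have "\<dots> \<le> cmod (1 / z) * (norm ?R * norm A + 1)"
    using norm_triangle_ineq4[of "?R o\<^sub>L A" id_blinfun] norm_blinfun_compose[of ?R A]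
      norm_blinfun_id_le
    by (intro mult_left_mono) (auto intro: order_trans add_mono)
  finally have "norm ?R * (cmod z - norm A) \<le> 1"
    using z by (simp add: norm_divide divide_simps algebra_simps)
  then show "norm ?R \<le> 1 / (cmod z - norm A)"
    using assms by (simp add: divide_simps)
qed

lemma resolvent_at_infinity: "(resolvent J A \<longlongrightarrow> 0) at_infinity"
proof (rule Lim_null_comparison)
  have "\<forall>\<^sub>F z in at_infinity. cmod z > norm A"
    unfolding eventually_at_infinity by (rule exI[of _ "norm A + 1"]) auto
  then show "\<forall>\<^sub>F z in at_infinity. norm (resolvent J A z) \<le> 1 / (cmod z - norm A)"
    by eventually_elim (rule large_not_in_spectrum)
  have "filterlim (\<lambda>z. - norm A + cmod z) at_top at_infinity"
    by (intro filterlim_tendsto_add_at_top[OF tendsto_const] filterlim_norm_at_top)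
  then show "((\<lambda>z. 1 / (cmod z - norm A)) \<longlongrightarrow> 0) at_infinity"
    using tendsto_inverse_0_at_top by (auto simp: inverse_eq_divide)
qed

end

section \<open>The Riesz projection\<close>

context complex_operator
begin

section \<open>Chain integrals and composition of operators\<close>

lemma chain_int_compose_left:
  assumes "continuous_on (chain_support K) f"
  shows "chain_int K (\<lambda>z. M o\<^sub>L f z) = M o\<^sub>L chain_int K f"
  by (rule chain_int_bounded_linear[where T = "\<lambda>X. M o\<^sub>L X"])
    (auto simp: assms comp_assoc bounded_bilinear.bounded_linear_right[OF bounded_bilinear_blinfun_compose])

text \<open>Scalars also act from the right, so \<open>M\<close> has to commute with them; for
  composition on the left associativity is enough.\<close>

lemma chain_int_compose_right:
  assumes "continuous_on (chain_support K) f" "M \<in> BX J"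
  shows "chain_int K (\<lambda>z. f z o\<^sub>L M) = chain_int K f o\<^sub>L M"
  by (rule chain_int_bounded_linear[where T = "\<lambda>X. X o\<^sub>L M"])
    (auto simp: assms comp_assoc BX_commute_cI
      bounded_bilinear.bounded_linear_left[OF bounded_bilinear_blinfun_compose])

lemma chain_int_commute:
  assumes "continuous_on (chain_support K) f" "M \<in> BX J"
    "\<And>z. z \<in> chain_support K \<Longrightarrow> M o\<^sub>L f z = f z o\<^sub>L M"
  shows "M o\<^sub>L chain_int K f = chain_int K f o\<^sub>L M"
  using chain_int_compose_left[OF assms(1), of M] chain_int_compose_right[OF assms(1,2)]
    chain_int_cong[of K "\<lambda>z. M o\<^sub>L f z" "\<lambda>z. f z o\<^sub>L M"] assms(3) by simp

text \<open>\<open>BX J\<close> is the commutant of \<open>J\<close>, and \<open>J\<close> lies in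
  it, so the commutation lemma applies to \<open>J\<close> itself.\<close>

lemma chain_int_in_BX:
  assumes "continuous_on (chain_support K) f" "\<And>z. z \<in> chain_support K \<Longrightarrow> f z \<in> BX J"
  shows "chain_int K f \<in> BX J"
proof -
  have "J \<in> BX J"
    by (simp add: BX_def)
  with assms have "J o\<^sub>L chain_int K f = chain_int K f o\<^sub>L J"
    by (intro chain_int_commute) (auto simp: BX_def)
  then show ?thesis
    by (simp add: BX_def)
qed

section \<open>Cauchy integrals of the resolvent over a chain off the spectrum\<close>

context
  fixes K :: "(complex \<times> complex) list"
  assumes K: "chain_support K \<inter> op_spectrum J A = {}"
begin

lemma continuous_on_chain_resolvent: "continuous_on (chain_support K) (resolvent J A)"
  by (rule continuous_on_subset[OF continuous_on_resolvent]) (use K in auto)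

lemma chain_resolvent_commute: "A o\<^sub>L chain_int K (resolvent J A) = chain_int K (resolvent J A) o\<^sub>L A"
  using A K by (intro chain_int_commute continuous_on_chain_resolvent resolvent_commute) auto

lemma chain_resolvent_in_BX: "chain_int K (resolvent J A) \<in> BX J"
  using K by (intro chain_int_in_BX continuous_on_chain_resolvent resolvent_in_BX) auto

text \<open>The function \<open>F\<close> of the overview without the factor 1/(2 pi i). It makes
  sense at points of the spectrum, which the chain avoids.\<close>

definition cauchy_resolvent :: "complex \<Rightarrow> 'x \<Rightarrow>\<^sub>L 'x" where
  "cauchy_resolvent \<mu> = chain_int K (\<lambda>l. resolvent J A l o\<^sub>L cI J (1 / (l - \<mu>)))"

context
  fixes \<mu>
  assumes \<mu>: "\<mu> \<notin> chain_support K"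
begin

lemma continuous_on_cauchy_integrand:
  "continuous_on (chain_support K) f \<Longrightarrow> continuous_on (chain_support K) (\<lambda>l. f l o\<^sub>L cI J (1 / (l - \<mu>)))"
  by (intro continuous_on continuous_intros bounded_linear.continuous_on[OF bounded_linear_cI])
    (use \<mu> in auto)

lemma cauchy_resolvent_in_BX: "cauchy_resolvent \<mu> \<in> BX J"
  unfolding cauchy_resolvent_def using K resolvent_in_BX
  by (intro chain_int_in_BX continuous_on_cauchy_integrand continuous_on_chain_resolvent) auto

text \<open>Split \<open>A - \<mu>\<close> as \<open>(A - l) + (l - \<mu>)\<close> under the
  integral. For the chain of a Cauchy contour the first summand yields the winding number and the
  second the projection, up to the factors 2 pi i and -2 pi i.\<close>

lemma cauchy_resolvent_left:
  "(A - cI J \<mu>) o\<^sub>L cauchy_resolvent \<mu>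
    = chain_int K (\<lambda>l. id_blinfun o\<^sub>L cI J (1 / (l - \<mu>))) + chain_int K (resolvent J A)"
proof -
  let ?R = "resolvent J A"
  have "(A - cI J \<mu>) o\<^sub>L cauchy_resolvent \<mu>
      = chain_int K (\<lambda>l. (A - cI J \<mu>) o\<^sub>L (?R l o\<^sub>L cI J (1 / (l - \<mu>))))"
    unfolding cauchy_resolvent_def
    by (intro chain_int_compose_left[symmetric] continuous_on_cauchy_integrand continuous_on_chain_resolvent)
  also have "\<dots> = chain_int K (\<lambda>l. (id_blinfun o\<^sub>L cI J (1 / (l - \<mu>))) + ?R l)"
  proof (rule chain_int_cong)
    fix l assume l: "l \<in> chain_support K"
    then have l': "l \<notin> op_spectrum J A" "l - \<mu> \<noteq> 0"
      using K \<mu> by auto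
    have "A - cI J \<mu> = (A - cI J l) + cI J (l - \<mu>)"
      by (simp add: cI_linear)
    then have "(A - cI J \<mu>) o\<^sub>L ?R l = id_blinfun + (?R l o\<^sub>L cI J (l - \<mu>))"
      using resolvent_right[OF l'(1)] BX_commute_cI[OF resolvent_in_BX[OF l'(1)]]
      by (simp only: comp_bilinear_simps(1))
    then have "(A - cI J \<mu>) o\<^sub>L (?R l o\<^sub>L cI J (1 / (l - \<mu>)))
        = (id_blinfun + (?R l o\<^sub>L cI J (l - \<mu>))) o\<^sub>L cI J (1 / (l - \<mu>))"
      by (metis comp_assoc)
    also have "\<dots> = (id_blinfun o\<^sub>L cI J (1 / (l - \<mu>))) + (?R l o\<^sub>L cI J ((l - \<mu>) * (1 / (l - \<mu>))))"
      by (simp only: comp_bilinear_simps(1) comp_assoc cI_mult)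
    finally show "(A - cI J \<mu>) o\<^sub>L (?R l o\<^sub>L cI J (1 / (l - \<mu>)))
        = (id_blinfun o\<^sub>L cI J (1 / (l - \<mu>))) + ?R l"
      using l'(2) by simp
  qed
  also have "\<dots> = chain_int K (\<lambda>l. id_blinfun o\<^sub>L cI J (1 / (l - \<mu>))) + chain_int K ?R"
    by (intro chain_int_add continuous_on_cauchy_integrand continuous_on_const continuous_on_chain_resolvent)
  finally show ?thesis .
qed

lemma cauchy_resolvent_commute:
  "(A - cI J \<mu>) o\<^sub>L cauchy_resolvent \<mu> = cauchy_resolvent \<mu> o\<^sub>L (A - cI J \<mu>)"
  unfolding cauchy_resolvent_def
proof (intro chain_int_commute continuous_on_cauchy_integrand continuous_on_chain_resolvent)
  show M: "A - cI J \<mu> \<in> BX J"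
    using A by auto
  fix l assume "l \<in> chain_support K"
  then have "(A - cI J \<mu>) o\<^sub>L resolvent J A l = resolvent J A l o\<^sub>L (A - cI J \<mu>)"
    using K A M by (intro resolvent_commute) (auto simp: comp_bilinear_simps BX_commute_cI)
  then show "(A - cI J \<mu>) o\<^sub>L (resolvent J A l o\<^sub>L cI J (1 / (l - \<mu>)))
      = (resolvent J A l o\<^sub>L cI J (1 / (l - \<mu>))) o\<^sub>L (A - cI J \<mu>)"
    using BX_commute_cI[OF M] by (metis comp_assoc)
qed

end

lemma C1_holo_cauchy_resolvent: "C1_holo cauchy_resolvent (- chain_support K)"
  unfolding cauchy_resolvent_def by (rule C1_holo_cauchy_transform[OF continuous_on_chain_resolvent])

end

lemma C1_holo_compose_left: "C1_holo f U \<Longrightarrow> C1_holo (\<lambda>z. M o\<^sub>L f z) U"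
  by (rule C1_holo_bounded_linear[where T = "\<lambda>X. M o\<^sub>L X"])
    (auto simp: comp_assoc bounded_bilinear.bounded_linear_right[OF bounded_bilinear_blinfun_compose])

section \<open>Idempotence of the Riesz projection\<close>

text \<open>Winding numbers are prescribed on the spectrum only. Local constancy carries them to
  small balls, and there the Cauchy transform continues \<open>P (1 - P) R_z\<close> across the
  spectrum.\<close>

lemma riesz_projection_idempotent:
  assumes K: "chain_support K \<inter> op_spectrum J A = {}" "chain_closed K"
    and \<Lambda>: "spectral_set J A \<Lambda>"
    and wind1: "\<And>z. z \<in> \<Lambda> \<Longrightarrow> chain_int K (\<lambda>l. id_blinfun o\<^sub>L cI J (1 / (l - z))) = cI J (2 * pi * \<i>)"
    and wind0: "\<And>z. z \<in> op_spectrum J A - \<Lambda> \<Longrightarrow> chain_int K (\<lambda>l. id_blinfun o\<^sub>L cI J (1 / (l - z))) = 0"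
    and P_def: "P = cI J (- 1 / (2 * pi * \<i>)) o\<^sub>L chain_int K (resolvent J A)"
  shows "P o\<^sub>L P = P"
proof -
  let ?R = "resolvent J A" and ?\<sigma> = "op_spectrum J A"
  define F where "F \<mu> = cI J (1 / (2 * pi * \<i>)) o\<^sub>L cauchy_resolvent K \<mu>" for \<mu>
  define Q where "Q = P o\<^sub>L (id_blinfun - P)"
  have Q': "Q = (id_blinfun - P) o\<^sub>L P"
    by (simp add: Q_def comp_bilinear_simps)
  have F: "F \<mu> o\<^sub>L (A - cI J \<mu>)
      = (cI J (1 / (2 * pi * \<i>)) o\<^sub>L chain_int K (\<lambda>l. id_blinfun o\<^sub>L cI J (1 / (l - \<mu>)))) - P"
    if "\<mu> \<notin> chain_support K" for \<mu>
  proof -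
    have "cI J (- 1 / (2 * pi * \<i>)) = - cI J (1 / (2 * pi * \<i>))"
      by (simp flip: cI_linear(3))
    then show ?thesis
      unfolding F_def comp_assoc cauchy_resolvent_commute[OF K(1) that, symmetric]
        cauchy_resolvent_left[OF K(1) that] P_def by (simp add: comp_bilinear_simps)
  qed
  \<comment> \<open>Off the spectrum this turns an equation for \<open>F z\<close> times
    \<open>A - z\<close> into a formula for \<open>F z\<close> through the resolvent.\<close>
  have cancel: "T = S o\<^sub>L ?R z" if "z \<notin> ?\<sigma>" "T o\<^sub>L (A - cI J z) = S" for S T z
    using comp_assoc[of T "A - cI J z" "?R z"] resolvent_right[OF that(1)] that(2) by simp
  have FC1: "C1_holo (\<lambda>z. M o\<^sub>L F z) V" if "V \<subseteq> - chain_support K" for M V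
    unfolding F_def
    by (intro C1_holo_compose_left C1_holo_subset[OF C1_holo_cauchy_resolvent[OF K(1)] that])
  have F1: "F z o\<^sub>L (A - cI J z) = id_blinfun - P" if "z \<notin> chain_support K"
    "chain_int K (\<lambda>l. id_blinfun o\<^sub>L cI J (1 / (l - z))) = cI J (2 * pi * \<i>)" for z
    unfolding F[OF that(1)] that(2) by (simp flip: cI_mult)
  have F0: "F z o\<^sub>L (A - cI J z) = - P" if "z \<notin> chain_support K"
    "chain_int K (\<lambda>l. id_blinfun o\<^sub>L cI J (1 / (l - z))) = 0" for z
    unfolding F[OF that(1)] that(2) by simp
  \<comment> \<open>The three formulas agree where they overlap: near \<open>\<Lambda>\<close>,
    \<open>F z\<close> times \<open>A - z\<close> is \<open>1 - P\<close>, and near the rest of the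
    spectrum it is \<open>- P\<close>, which accounts for the sign in the last one.\<close>
  define G where "G z = (if z \<notin> ?\<sigma> then Q o\<^sub>L ?R z else if z \<in> \<Lambda> then P o\<^sub>L F z
      else - ((id_blinfun - P) o\<^sub>L F z))" for z
  have \<Lambda>': "\<Lambda> \<subseteq> ?\<sigma>" "closed \<Lambda>" "closed (?\<sigma> - \<Lambda>)"
    using \<Lambda> by (auto simp: spectral_set_def)
  have "\<exists>V. open V \<and> z \<in> V \<and> C1_holo G V" for z
  proof -
    consider "z \<notin> ?\<sigma>" | "z \<in> \<Lambda>" | "z \<in> ?\<sigma> - \<Lambda>"
      by blast
    then show ?thesis
    proof cases
      case 1
      have "C1_holo G (- ?\<sigma>)"
        by (rule C1_holo_transform_open[OF C1_holo_compose_left[OF C1_holo_resolvent, of Q] open_resolvent_set])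
          (simp add: G_def)
      with 1 open_resolvent_set show ?thesis
        by blast
    next
      case 2
      \<comment> \<open>Both parts of the spectrum are closed, so a small ball about
        \<open>z\<close> misses the chain and meets the spectrum only in
        \<open>\<Lambda>\<close>.\<close>
      have "open (- (chain_support K \<union> (?\<sigma> - \<Lambda>)))" "z \<in> - (chain_support K \<union> (?\<sigma> - \<Lambda>))"
        using \<Lambda>' 2 K(1) by (intro open_Compl closed_Un closed_chain_support, auto)
      then obtain e where e: "e > 0" "ball z e \<subseteq> - (chain_support K \<union> (?\<sigma> - \<Lambda>))"
        using open_contains_ball by metis
      have "C1_holo G (ball z e)"
      proof (rule C1_holo_transform_open)
        show "C1_holo (\<lambda>w. P o\<^sub>L F w) (ball z e)"
          using e(2) by (intro FC1) auto
        fix w assume w: "w \<in> ball z e"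
        then have "chain_int K (\<lambda>l. id_blinfun o\<^sub>L cI J (1 / (l - w))) = cI J (2 * pi * \<i>)"
          using winding_locally_constant[OF K(2), of "ball z e" w z id_blinfun] e wind1[OF 2] by auto
        then have "F w o\<^sub>L (A - cI J w) = id_blinfun - P"
          using w e(2) by (intro F1) auto
        then have "P o\<^sub>L F w = Q o\<^sub>L ?R w" if "w \<notin> ?\<sigma>"
          using cancel[OF that, of "F w" "id_blinfun - P"] by (simp only: Q_def comp_assoc)
        with w e(2) show "P o\<^sub>L F w = G w"
          by (auto simp: G_def)
      qed simp
      with e(1) show ?thesis
        by (intro exI[of _ "ball z e"]) auto
    next
      case 3
      have "open (- (chain_support K \<union> \<Lambda>))" "z \<in> - (chain_support K \<union> \<Lambda>)"
        using \<Lambda>' 3 K(1) by (intro open_Compl closed_Un closed_chain_support, auto)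
      then obtain e where e: "e > 0" "ball z e \<subseteq> - (chain_support K \<union> \<Lambda>)"
        using open_contains_ball by metis
      have "C1_holo G (ball z e)"
      proof (rule C1_holo_transform_open)
        show "C1_holo (\<lambda>w. (- (id_blinfun - P)) o\<^sub>L F w) (ball z e)"
          using e(2) by (intro FC1) auto
        fix w assume w: "w \<in> ball z e"
        then have "chain_int K (\<lambda>l. id_blinfun o\<^sub>L cI J (1 / (l - w))) = 0"
          using winding_locally_constant[OF K(2), of "ball z e" w z id_blinfun] e wind0[OF 3] by auto
        then have "F w o\<^sub>L (A - cI J w) = - P"
          using w e(2) by (intro F0) auto
        then have "(- (id_blinfun - P)) o\<^sub>L F w = Q o\<^sub>L ?R w" if "w \<notin> ?\<sigma>"
          using cancel[OF that, of "F w" "- P"]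
          by (simp only: Q' comp_assoc comp_bilinear_simps(5,6) minus_minus)
        with w e(2) show "(- (id_blinfun - P)) o\<^sub>L F w = G w"
          by (auto simp: G_def comp_bilinear_simps(5) simp del: minus_diff_eq)
      qed simp
      with e(1) show ?thesis
        by (intro exI[of _ "ball z e"]) auto
    qed
  qed
  then have "C1_holo G UNIV"
    by (intro C1_holo_locally) blast
  moreover have "(G \<longlongrightarrow> 0) at_infinity"
  proof (rule Lim_transform_eventually)
    show "((\<lambda>z. Q o\<^sub>L ?R z) \<longlongrightarrow> 0) at_infinity"
      using bounded_bilinear.tendsto_right_zero[OF bounded_bilinear_blinfun_compose resolvent_at_infinity] .
    have "\<forall>\<^sub>F z in at_infinity. cmod z > norm A"
      unfolding eventually_at_infinity by (rule exI[of _ "norm A + 1"]) auto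
    then show "\<forall>\<^sub>F z in at_infinity. Q o\<^sub>L ?R z = G z"
      by eventually_elim (simp add: G_def large_not_in_spectrum)
  qed
  ultimately have G0: "G 0 = 0"
    by (rule liouville_vanishing)
  \<comment> \<open>Liouville's theorem gives the value at 0 only, but that suffices: whichever
    formula defines \<open>G 0\<close>, multiplication by \<open>A\<close> recovers
    \<open>Q\<close>.\<close>
  have "G 0 o\<^sub>L (A - cI J 0) = Q"
  proof -
    consider "0 \<notin> ?\<sigma>" | "0 \<in> \<Lambda>" | "0 \<in> ?\<sigma> - \<Lambda>"
      by blast
    then show ?thesis
    proof cases
      case 1
      then show ?thesis
        by (simp only: G_def if_True comp_assoc resolvent_left not_False_eq_True comp_id)
    next
      case 2
      then have "F 0 o\<^sub>L (A - cI J 0) = id_blinfun - P"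
        using \<Lambda>' K(1) by (intro F1 wind1) auto
      then show ?thesis
        using 2 \<Lambda>' by (auto simp: G_def comp_assoc Q_def simp del: cI_0)
    next
      case 3
      then have "F 0 o\<^sub>L (A - cI J 0) = - P"
        using \<Lambda>' K(1) by (intro F0 wind0) auto
      then show ?thesis
        using 3 by (auto simp: G_def comp_assoc Q' comp_bilinear_simps(5,6) simp del: cI_0)
    qed
  qed
  then have "Q = 0"
    using G0 by simp
  then show ?thesis
    by (simp add: Q_def comp_bilinear_simps)
qed

end

section \<open>Inversion along an idempotent, and the conclusion\<close>

text \<open>From \<open>P S = S A S = S P\<close> and \<open>A P = A S A = P A\<close>, the operator
  \<open>B = S P\<close> satisfies \<open>A B = B A = P\<close> and \<open>P B = B\<close>. The
  factorizations are \<open>B = P S = S P\<close> and \<open>P = B A = A B\<close>.\<close>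

lemma mary_invertible_along_idempotent:
  assumes "A \<in> BX J" "P \<in> BX J" "S \<in> BX J" and P: "P o\<^sub>L P = P" and S: "S o\<^sub>L A = P" "A o\<^sub>L S = P"
  shows "mary_invertible_along J A P"
proof -
  have PS: "P o\<^sub>L S = S o\<^sub>L P"
    using comp_assoc[of S A S] S by simp
  have AP: "A o\<^sub>L P = P o\<^sub>L A"
    using comp_assoc[of A S A] S by simp
  have "A o\<^sub>L (S o\<^sub>L P) = P"
    using comp_assoc[of A S P] P S by simp
  moreover have "(S o\<^sub>L P) o\<^sub>L A = P"
    using comp_assoc[of S P A] comp_assoc[of S A P] P S AP by simp
  moreover have "P o\<^sub>L (S o\<^sub>L P) = S o\<^sub>L P"
    using comp_assoc[of P S P] comp_assoc[of S P P] P PS by simp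
  ultimately show ?thesis
    unfolding mary_invertible_along_def using assms(1-3) PS
    by (intro bexI[of _ "S o\<^sub>L P"] conjI bexI[of _ S] bexI[of _ A]) auto
qed

theorem theorem4p2:
  fixes J A :: "'x::banach \<Rightarrow>\<^sub>L 'x"
    and \<Lambda> :: "complex set"
    and C :: "(real \<Rightarrow> complex) list"
  assumes "complex_structure J"
    and "A \<in> BX J"
    and "spectral_set J A \<Lambda>"
    and "cauchy_contour J A \<Lambda> C"
    and "0 \<notin> \<Lambda>"
  shows "mary_invertible_along J A (spectral_projection J A C)"
proof -
  interpret complex_operator J A
    using assms by unfold_locales
  let ?R = "resolvent J A" and ?\<rho> = "- op_spectrum J A"
  \<comment> \<open>The contour is replaced by one closed chain that works for all integrands at
    once, so that the resolvent and the winding kernels can share it. Each path contributes a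
    polygon, closed because the path is.\<close>
  have "\<exists>K. chain_support K \<subseteq> ?\<rho> \<and> chain_closed K \<and>
      (\<forall>f. C1_holo f ?\<rho> \<longrightarrow> (\<Sum>g\<leftarrow>D. op_contour_integral J g f) = chain_int K f)"
    if "\<forall>g\<in>set D. valid_path g \<and> pathfinish g = pathstart g \<and> path_image g \<subseteq> ?\<rho>" for D
    using that
  proof (induction D)
    case Nil
    then show ?case
      by (intro exI[of _ "[]"]) (auto simp: chain_closed_def)
  next
    case (Cons g D)
    then obtain K where K: "chain_support K \<subseteq> ?\<rho>" "chain_closed K"
      "\<And>f. C1_holo f ?\<rho> \<Longrightarrow> (\<Sum>g\<leftarrow>D. op_contour_integral J g f) = chain_int K f"
      by auto
    have g: "valid_path g" "path_image g \<subseteq> ?\<rho>" "g 1 = g 0"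
      using Cons.prems by (auto simp: pathfinish_def pathstart_def)
    from valid_path_polygonal_chain[OF g(1,2) open_resolvent_set]
    obtain L where L: "chain_support L \<subseteq> ?\<rho>"
      "add_mset (g 1) (mset (map fst L)) = add_mset (g 0) (mset (map snd L))"
      "\<And>f. C1_holo f ?\<rho> \<Longrightarrow>
        ((\<lambda>t. f (g t) o\<^sub>L cI J (vector_derivative g (at t within {0..1}))) has_integral chain_int L f) {0..1}"
      by blast
    have "op_contour_integral J g f = chain_int L f" if "C1_holo f ?\<rho>" for f
      unfolding op_contour_integral_def using L(3)[OF that] by (rule integral_unique)
    with K L(1,2) g(3) show ?case
      by (intro exI[of _ "L @ K"]) (auto simp: chain_closed_def)
  qed
  from this[of C] assms(4) obtain K where K: "chain_support K \<subseteq> ?\<rho>" "chain_closed K"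
    "\<And>f. C1_holo f ?\<rho> \<Longrightarrow> (\<Sum>g\<leftarrow>C. op_contour_integral J g f) = chain_int K f"
    unfolding cauchy_contour_def by blast
  have K1: "chain_support K \<inter> op_spectrum J A = {}"
    using K(1) by auto
  \<comment> \<open>The kernel \<open>1 / (l - z)\<close> is holomorphic on the resolvent set
    because \<open>z\<close> is in the spectrum, so winding numbers transfer from the contour to the
    chain.\<close>
  have wind: "chain_int K (\<lambda>l. id_blinfun o\<^sub>L cI J (1 / (l - z)))
      = cI J (2 * pi * \<i> * (\<Sum>g\<leftarrow>C. winding_number g z))" if z: "z \<in> op_spectrum J A" for z
  proof -
    have "C1_holo (\<lambda>l. id_blinfun o\<^sub>L cI J (1 / (l - z))) ?\<rho>"
    proof (rule C1_holoI)
      show "has_cderiv (\<lambda>l. id_blinfun o\<^sub>L cI J (1 / (l - z))) (id_blinfun o\<^sub>L cI J (- 1 / ((l - z) * (l - z)))) l"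
        if "l \<in> ?\<rho>" for l
        by (intro has_cderiv_field_derivative) (use that z in \<open>auto intro!: derivative_eq_intros\<close>)
      show "continuous_on ?\<rho> (\<lambda>l. id_blinfun o\<^sub>L cI J (- 1 / ((l - z) * (l - z))))"
        by (intro continuous_on continuous_intros bounded_linear.continuous_on[OF bounded_linear_cI])
          (use z in auto)
    qed
    then have "chain_int K (\<lambda>l. id_blinfun o\<^sub>L cI J (1 / (l - z)))
        = (\<Sum>g\<leftarrow>C. op_contour_integral J g (\<lambda>l. id_blinfun o\<^sub>L cI J (1 / (l - z))))"
      by (rule K(3)[symmetric])
    also have "\<dots> = (\<Sum>g\<leftarrow>C. cI J (2 * pi * \<i> * winding_number g z))"
    proof (rule arg_cong[where f = sum_list], rule map_cong[OF refl])
      fix g assume "g \<in> set C"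
      then have "valid_path g" "z \<notin> path_image g"
        using assms(4) z unfolding cauchy_contour_def by blast+
      then have "((\<lambda>t. 1 / (g t - z) * vector_derivative g (at t within {0..1})) has_integral
          (2 * pi * \<i> * winding_number g z)) {0..1}"
        using has_contour_integral_winding_number unfolding has_contour_integral_def by blast
      \<comment> \<open>The operator integral is the image of the scalar winding integral under the
        bounded linear map \<open>cI J\<close>.\<close>
      from has_integral_linear[OF this bounded_linear_cI]
      show "op_contour_integral J g (\<lambda>l. id_blinfun o\<^sub>L cI J (1 / (l - z))) = cI J (2 * pi * \<i> * winding_number g z)"
        unfolding op_contour_integral_def comp_id o_def cI_mult[symmetric] by (rule integral_unique)
    qed
    also have "\<dots> = cI J (\<Sum>g\<leftarrow>C. 2 * pi * \<i> * winding_number g z)"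
      by (induction C) (auto simp: cI_linear)
    finally show ?thesis
      by (simp add: sum_list_const_mult)
  qed
  have wind1: "chain_int K (\<lambda>l. id_blinfun o\<^sub>L cI J (1 / (l - z))) = cI J (2 * pi * \<i>)" if "z \<in> \<Lambda>" for z
    using wind[of z] that assms(3,4) by (auto simp: spectral_set_def cauchy_contour_def)
  have wind0: "chain_int K (\<lambda>l. id_blinfun o\<^sub>L cI J (1 / (l - z))) = 0" if "z \<in> op_spectrum J A - \<Lambda>" for z
    using wind[of z] that assms(4) by (auto simp: cauchy_contour_def)
  define P where "P = spectral_projection J A C"
  have P: "P = cI J (- 1 / (2 * pi * \<i>)) o\<^sub>L chain_int K ?R"
    unfolding P_def spectral_projection_def K(3)[OF C1_holo_resolvent] by simp
  have PP: "P o\<^sub>L P = P"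
    by (rule riesz_projection_idempotent[OF K1 K(2) assms(3) wind1 wind0 P])
  have PBX: "P \<in> BX J"
    unfolding P using chain_resolvent_in_BX[OF K1] by auto
  obtain S where "S \<in> BX J" "S o\<^sub>L A = P" "A o\<^sub>L S = P"
  proof (cases "0 \<in> op_spectrum J A")
    case True
    then have 0: "0 \<notin> chain_support K" "0 \<in> op_spectrum J A - \<Lambda>"
      using K1 assms(5) by auto
    \<comment> \<open>This is \<open>- F(0)\<close>. The winding number at 0 vanishes because 0 is
      in the spectrum but not in \<open>\<Lambda>\<close>, so multiplication by \<open>A\<close>
      leaves exactly the integral that defines \<open>P\<close>.\<close>
    let ?S = "cI J (- 1 / (2 * pi * \<i>)) o\<^sub>L cauchy_resolvent K 0"
    have l: "A o\<^sub>L cauchy_resolvent K 0 = chain_int K ?R"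
      using cauchy_resolvent_left[OF K1 0(1)] wind0[OF 0(2)] by simp
    moreover have "cauchy_resolvent K 0 o\<^sub>L A = chain_int K ?R"
      using cauchy_resolvent_commute[OF K1 0(1)] l by simp
    moreover have "A o\<^sub>L ?S = cI J (- 1 / (2 * pi * \<i>)) o\<^sub>L (A o\<^sub>L cauchy_resolvent K 0)"
      by (metis comp_assoc BX_commute_cI[OF assms(2)])
    ultimately have "?S o\<^sub>L A = P" "A o\<^sub>L ?S = P"
      by (simp_all add: P comp_assoc)
    moreover have "?S \<in> BX J"
      using cauchy_resolvent_in_BX[OF K1 0(1)] by auto
    ultimately show ?thesis
      using that by blast
  next
    case False
    \<comment> \<open>The witness here is the inverse of \<open>A\<close> times \<open>P\<close>;
      multiplied by \<open>A\<close> on the right it gives \<open>P\<close> only because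
      \<open>P\<close> commutes with \<open>A\<close>.\<close>
    have AP: "A o\<^sub>L P = P o\<^sub>L A"
      unfolding P by (metis comp_assoc BX_commute_cI[OF assms(2)] chain_resolvent_commute[OF K1])
    have "?R 0 o\<^sub>L A = id_blinfun" "A o\<^sub>L ?R 0 = id_blinfun"
      using resolvent_left[OF False] resolvent_right[OF False] by auto
    then have "A o\<^sub>L (?R 0 o\<^sub>L P) = P" "(?R 0 o\<^sub>L P) o\<^sub>L A = P"
      by (metis comp_assoc comp_id(1)) (metis AP comp_assoc comp_id(1) \<open>?R 0 o\<^sub>L A = id_blinfun\<close>)
    moreover have "?R 0 o\<^sub>L P \<in> BX J"
      using resolvent_in_BX[OF False] PBX by auto
    ultimately show ?thesis
      using that by blast
  qed
  with assms(2) PBX PP show ?thesis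
    unfolding P_def[symmetric] by (intro mary_invertible_along_idempotent) auto
qed

end
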